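(* Let $0<s<1$ and $1<p<\infty$ satisfy $sp<n$. Suppose $G\neq\emptyset$ is a bounded open set in $\mathbb{R}^n$. Then the following conditions are equivalent. (1) $G$ admits an $(s,p)$-Hardy inequality; (2) $\mathrm{cap}_{s,p}(\cdot,G)$ is $\mathcal{W}(G)$-quasiadditive and $G$ admits an $(s,p)$-zero extension; (3) $\mathrm{cap}_{s,p}(\cdot,G)$ is weakly $\mathcal{W}(G)$-quasiadditive and $G$ admits an $(s,p)$-zero extension. Moreover, the implications (1) $\Rightarrow$ (2) $\Rightarrow$ (3) hold also for unbounded (nonempty) open sets $G\subsetneq\mathbb{R}^n$.
   Context: $C_c(G)$ denotes the space of (real-valued) continuous functions with compact support in $G$. For an open set $G\subset\mathbb{R}^n$ and a measurable function $u$ on $G$, put $$|u|_{W^{s,p}(G)}=\left(\int_G\int_G\frac{|u(x)-u(y)|^p}{|x-y|^{n+sp}}\,dy\,dx\right)^{1/p}\in[0,\infty].$$ Hardy inequality: an open set $\emptyset\neq G\subsetneq\mathbb{R}^n$ admits an $(s,p)$-Hardy inequality if there is a constant $C>0$ such that $\int_G |u(x)|^p\,\mathrm{dist}(x,\partial G)^{-sp}\,dx\le C\,|u|_{W^{s,p}(G)}^p$ for every $u\in C_c(G)$. Capacity: for a compact set $K\subset G$, $\mathrm{cap}_{s,p}(K,G)=\inf_u |u|_{W^{s,p}(G)}^p$, where the infimum ranges over all real-valued $u\in C_c(G)$ such that $u(x)\ge 1$ for every $x\in K$. Whitney cubes: for an open set $\emptyset\neq G\subsetneq\mathbb{R}^n$,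 $\mathcal{W}(G)$ is a fixed (standard) Whitney decomposition of $G$: a family of closed dyadic cubes with pairwise disjoint interiors such that $G=\bigcup_{Q\in\mathcal{W}(G)}Q$, $\mathrm{diam}(Q)\le\mathrm{dist}(Q,\partial G)\le 4\,\mathrm{diam}(Q)$ for each $Q\in\mathcal{W}(G)$, and $\sum_{Q\in\mathcal{W}(G)}\chi_{Q^{**}}\le C_n\chi_G$, where $Q^{**}=\tfrac98 Q$ is the concentric dilation of $Q$ and $C_n$ depends only on $n$. Quasiadditivity: $\mathrm{cap}_{s,p}(\cdot,G)$ is $\mathcal{W}(G)$-quasiadditive if there is a constant $N>0$ such that for every compact set $K\subset G$, $$\sum_{Q\in\mathcal{W}(G)}\mathrm{cap}_{s,p}(K\cap Q,G)\le N\,\mathrm{cap}_{s,p}(K,G).$$ It is weakly $\mathcal{W}(G)$-quasiadditive if there is a constant $N>0$ such that this inequality holds for every $K$ of the form $K=\bigcup_{Q\in\mathcal{E}}Q$ with $\mathcal{E}\subset\mathcal{W}(G)$ finite. Zero extension: $G$ admits an $(s,p)$-zero extension if there is a constant $C>0$ such that $|E_Gu|_{W^{s,p}(\mathbb{R}^n)}\le C\,|u|_{W^{s,p}(G)}$ for every $u\in C_c(G)$, where $E_Gu(x)=u(x)$ if $x\in G$ and $E_Gu(x)=0$ otherwise. *)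

theory Defs
  imports "HOL-Analysis.Analysis"
begin

text \<open>
  Functions on an open set \<open>G\<close> are represented by total functions; only their values on \<open>G\<close> matter.
  All integrals, seminorms and capacities take values in the extended nonnegative reals.
\<close>

definition compactly_supported :: "'a::topological_space set \<Rightarrow> ('a \<Rightarrow> real) set" where
  "compactly_supported G =
     {u. continuous_on G u \<and> compact (closure {x\<in>G. u x \<noteq> 0}) \<and> closure {x\<in>G. u x \<noteq> 0} \<subseteq> G}"

text \<open>Powers of extended nonnegative reals; the value at \<open>\<infinity>\<close> is the right one only for \<open>r > 0\<close>.\<close>

definition ennreal_powr :: "ennreal \<Rightarrow> real \<Rightarrow> ennreal" where
  "ennreal_powr a r = (if a = \<infinity> then \<infinity> else ennreal (enn2real a powr r))"

text \<open>
  On the diagonal \<open>x = y\<close>, a null set, the integrand is \<open>0 / 0 = 0\<close>.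
\<close>

definition gagliardo_energy ::
    "real \<Rightarrow> real \<Rightarrow> (real^'n) set \<Rightarrow> (real^'n \<Rightarrow> real) \<Rightarrow> ennreal" where
  "gagliardo_energy s p G u =
     (\<integral>\<^sup>+x\<in>G. (\<integral>\<^sup>+y\<in>G. ennreal (\<bar>u x - u y\<bar> powr p / norm (x - y) powr (real CARD('n) + s * p))
        \<partial>lborel) \<partial>lborel)"

definition gagliardo_seminorm ::
    "real \<Rightarrow> real \<Rightarrow> (real^'n) set \<Rightarrow> (real^'n \<Rightarrow> real) \<Rightarrow> ennreal" where
  "gagliardo_seminorm s p G u = ennreal_powr (gagliardo_energy s p G u) (1 / p)"

lemma gagliardo_seminorm_powr:
  assumes "p > 0"
  shows "ennreal_powr (gagliardo_seminorm s p G u) p = gagliardo_energy s p G u"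
  using assms by (auto simp: gagliardo_seminorm_def ennreal_powr_def powr_powr less_top)

definition hardy_inequality :: "real \<Rightarrow> real \<Rightarrow> (real^'n) set \<Rightarrow> bool" where
  "hardy_inequality s p G \<longleftrightarrow>
     (\<exists>C>0. \<forall>u\<in>compactly_supported G.
        (\<integral>\<^sup>+x\<in>G. ennreal (\<bar>u x\<bar> powr p * infdist x (frontier G) powr (- (s * p))) \<partial>lborel)
          \<le> ennreal C * ennreal_powr (gagliardo_seminorm s p G u) p)"

definition capacity :: "real \<Rightarrow> real \<Rightarrow> (real^'n) set \<Rightarrow> (real^'n) set \<Rightarrow> ennreal" where
  "capacity s p K G =
     (INF u \<in> {u \<in> compactly_supported G. \<forall>x\<in>K. u x \<ge> 1}.
        ennreal_powr (gagliardo_seminorm s p G u) p)"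

definition dyadic_cube :: "(real^'n) set \<Rightarrow> bool" where
  "dyadic_cube Q \<longleftrightarrow>
     (\<exists>(k::int) (m :: 'n \<Rightarrow> int).
        Q = cbox (\<chi> i. 2 powi k * of_int (m i)) (\<chi> i. 2 powi k * (of_int (m i) + 1)))"

text \<open>Concentric dilation; meaningful for nonempty boxes, whose centre is the midpoint used here.\<close>

definition dilate_cube :: "real \<Rightarrow> (real^'n) set \<Rightarrow> (real^'n) set" where
  "dilate_cube t Q =
     (let z = midpoint (interval_lowerbound Q) (interval_upperbound Q)
      in (\<lambda>x. z + t *\<^sub>R (x - z)) ` Q)"

text \<open>
  The parameter \<open>c\<close> is the overlap constant of the dilated cubes, which is to be chosen
  independently of \<open>G\<close>.
\<close>

definition whitney_decomposition :: "real \<Rightarrow> (real^'n) set \<Rightarrow> (real^'n) set set \<Rightarrow> bool" where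
  "whitney_decomposition c G W \<longleftrightarrow>
     (\<forall>Q\<in>W. dyadic_cube Q) \<and>
     (\<forall>Q\<in>W. \<forall>R\<in>W. Q \<noteq> R \<longrightarrow> interior Q \<inter> interior R = {}) \<and>
     G = \<Union>W \<and>
     (\<forall>Q\<in>W. diameter Q \<le> setdist Q (frontier G) \<and> setdist Q (frontier G) \<le> 4 * diameter Q) \<and>
     (\<forall>x. (\<Sum>\<^sub>\<infinity>Q\<in>W. indicator (dilate_cube (9/8) Q) x :: ennreal) \<le> ennreal c * indicator G x)"

definition quasiadditive ::
    "real \<Rightarrow> real \<Rightarrow> (real^'n) set \<Rightarrow> (real^'n) set set \<Rightarrow> bool" where
  "quasiadditive s p G W \<longleftrightarrow>
     (\<exists>N>0. \<forall>K. compact K \<and> K \<subseteq> G \<longrightarrow>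
        (\<Sum>\<^sub>\<infinity>Q\<in>W. capacity s p (K \<inter> Q) G) \<le> ennreal N * capacity s p K G)"

definition weakly_quasiadditive ::
    "real \<Rightarrow> real \<Rightarrow> (real^'n) set \<Rightarrow> (real^'n) set set \<Rightarrow> bool" where
  "weakly_quasiadditive s p G W \<longleftrightarrow>
     (\<exists>N>0. \<forall>E. E \<subseteq> W \<and> finite E \<longrightarrow>
        (\<Sum>\<^sub>\<infinity>Q\<in>W. capacity s p (\<Union>E \<inter> Q) G) \<le> ennreal N * capacity s p (\<Union>E) G)"

definition zero_ext :: "'a set \<Rightarrow> ('a \<Rightarrow> real) \<Rightarrow> 'a \<Rightarrow> real" where
  "zero_ext G u x = (if x \<in> G then u x else 0)"

definition admits_zero_extension :: "real \<Rightarrow> real \<Rightarrow> (real^'n) set \<Rightarrow> bool" where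
  "admits_zero_extension s p G \<longleftrightarrow>
     (\<exists>C>0. \<forall>u\<in>compactly_supported G.
        gagliardo_seminorm s p UNIV (zero_ext G u) \<le> ennreal C * gagliardo_seminorm s p G u)"

end

theory Submission
  imports Defs "HOL-Probability.Probability_Measure"
begin

text \<open>
  Write \<open>d\<close> for the distance to the boundary of \<open>G\<close>. If Hardy's inequality holds, the zero extension
  costs only \<open>\<integral>|u|\<^sup>p d\<^sup>-\<^sup>s\<^sup>p\<close>, and multiplying a test function by cutoffs of the Whitney cubes
  produces test functions for the pieces \<open>K \<inter> Q\<close> whose total energy is at most a
  multiple of the energy of \<open>u\<close> plus the same integral.

  Conversely, a zero extension bounds the capacity of a Whitney cube of side \<open>l\<close> below by a multiple
  of \<open>l\<^sup>n\<^sup>-\<^sup>s\<^sup>p\<close>: compare the averages of a test function over the concentric balls of radius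
  \<open>2\<^sup>j l\<close>; their differences form a geometric series because \<open>sp < n\<close>. Given \<open>u\<close>, let \<open>v\<close> be its
  average over the ball of radius \<open>d(x)/2\<close> about \<open>x\<close>. The energy of \<open>v\<close> is controlled by that of \<open>u\<close>,
  and on each cube \<open>u\<close> differs from \<open>b = min |v|\<close> only by a Poincare term. The remaining sum of
  \<open>b\<^sup>p l\<^sup>n\<^sup>-\<^sup>s\<^sup>p\<close> is split into dyadic levels, where weak quasiadditivity applies to the union of
  the cubes of one level, tested with a truncation of \<open>|v|\<close>.
\<close>

section \<open>Expanding maps\<close>

text \<open>Weak quasiadditivity tests only finite unions of whole Whitney cubes, whereas
  \<open>u\<close> may oscillate inside a cube and its level sets need not respect the cubes. The
  average repairs this: its value at any point of a cube stands for the whole cube up to a Poincare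
  error. The truncations at different levels can be added because they are slices of |v|, all
  increasing in |v|, whose increments sum to at most the increment of |v|.

  The averaging moves a point by a multiple of the distance function, which is Lipschitz but in
  general not differentiable. In place of a Jacobian, the proof uses that moved points stay at least
  half as far apart as before: preimages under such a map have controlled volume.

  Both consequences of Hardy's inequality rest on one kernel, which, truncated at scale t,
  integrates to a multiple of t^(-sp). For the zero extension the truncation is inactive, since a
  point outside \<open>G\<close> is at distance at least d(x) from \<open>x\<close>; for the cutoffs
  it reflects their Lipschitz constant, of order 1/d(x).\<close>

lemma emeasure_vimage_expanding_cube:
  fixes T :: "'a::euclidean_space \<Rightarrow> 'a"
  assumes c: "c > 0" and T: "\<And>x y. c * dist x y \<le> dist (T x) (T y)"
    and r: "r > 0" and ab: "\<And>i. i \<in> Basis \<Longrightarrow> b \<bullet> i - a \<bullet> i = r"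
  shows "emeasure lborel (T -` cbox a b)
    \<le> ennreal (unit_ball_vol DIM('a) * (DIM('a) / c) ^ DIM('a)) * emeasure lborel (cbox a b)"
proof (cases "T -` cbox a b = {}")
  case False
  then obtain x0 where x0: "T x0 \<in> cbox a b" by auto
  \<comment> \<open>Two points of the cube differ by at most \<open>r\<close> in each coordinate.
    Bounding their distance by the l1 norm gives \<open>DIM('a) * r\<close>, the origin of the power
    of the dimension in the constant.\<close>
  have "T -` cbox a b \<subseteq> cball x0 (DIM('a) * r / c)"
  proof
    fix x assume "x \<in> T -` cbox a b"
    then have x: "T x \<in> cbox a b" by simp
    have "dist (T x0) (T x) \<le> (\<Sum>i\<in>Basis. \<bar>(T x0 - T x) \<bullet> i\<bar>)"
      unfolding dist_norm by (rule norm_le_l1)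
    also have "\<dots> \<le> (\<Sum>i\<in>(Basis::'a set). r)"
    proof (rule sum_mono)
      fix i :: 'a assume i: "i \<in> Basis"
      then show "\<bar>(T x0 - T x) \<bullet> i\<bar> \<le> r"
        using x0 x ab[OF i] by (auto simp: mem_box inner_diff_left abs_le_iff dest!: bspec[OF _ i])
    qed
    finally have "c * dist x0 x \<le> DIM('a) * r" using T[of x0 x] by simp
    with c show "x \<in> cball x0 (DIM('a) * r / c)" by (simp add: field_simps)
  qed
  then have "emeasure lborel (T -` cbox a b) \<le> emeasure lborel (cball x0 (DIM('a) * r / c))"
    by (rule emeasure_mono) simp
  also have "\<dots> = ennreal (unit_ball_vol DIM('a) * (DIM('a) * r / c) ^ DIM('a))"
    using c r by (subst emeasure_cball) auto
  also have "\<dots> = ennreal (unit_ball_vol DIM('a) * (DIM('a) / c) ^ DIM('a)) * ennreal (r ^ DIM('a))"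
    using c r by (subst ennreal_mult[symmetric]) (auto simp: field_simps power_mult_distrib)
  also have "ennreal (r ^ DIM('a)) = emeasure lborel (cbox a b)"
  proof -
    have "emeasure lborel (cbox a b) = ennreal (\<Prod>i\<in>Basis. (b - a) \<bullet> i)"
      using ab r by (subst emeasure_lborel_cbox_eq) (smt (verit, best) )
    also have "(\<Prod>i\<in>Basis. (b - a) \<bullet> i) = (\<Prod>i\<in>(Basis::'a set). r)"
      by (rule prod.cong) (auto simp: inner_diff_left ab)
    finally show ?thesis by simp
  qed
  finally show ?thesis .
qed simp

lemma emeasure_UN_countable_le:
  assumes I: "countable I" and X: "\<And>i. i \<in> I \<Longrightarrow> X i \<in> sets M"
  shows "emeasure M (\<Union>i\<in>I. X i) \<le> (\<integral>\<^sup>+i. emeasure M (X i) \<partial>count_space I)"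
proof -
  have "emeasure M (\<Union>i\<in>I. X i) = (\<integral>\<^sup>+x. indicator (\<Union>i\<in>I. X i) x \<partial>M)"
    using I X by (intro nn_integral_indicator[symmetric] sets.countable_UN') auto
  also have "\<dots> \<le> (\<integral>\<^sup>+x. \<integral>\<^sup>+i. indicator (X i) x \<partial>count_space I \<partial>M)"
  proof (rule nn_integral_mono)
    fix x
    show "indicator (\<Union>i\<in>I. X i) x \<le> (\<integral>\<^sup>+i. indicator (X i) x \<partial>count_space I)"
      using nn_integral_ge_point[of _ I "\<lambda>i. indicator (X i) x"]
      by (force simp: indicator_def)
  qed
  also have "\<dots> = (\<integral>\<^sup>+i. \<integral>\<^sup>+x. indicator (X i) x \<partial>M \<partial>count_space I)"
    using I X by (intro nn_integral_count_space_nn_integral) auto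
  also have "\<dots> = (\<integral>\<^sup>+i. emeasure M (X i) \<partial>count_space I)"
    using X by (intro nn_integral_cong) auto
  finally show ?thesis .
qed

text \<open>An open set is covered by dyadic cubes with disjoint interiors and null boundaries, so
  the cube estimate can be summed. The balls of the gauge lie in \<open>U\<close>; this keeps the
  cubes of \<open>covering_lemma\<close> inside \<open>U\<close>, so that their total volume does
  not exceed that of \<open>U\<close>.\<close>

lemma emeasure_vimage_expanding_open:
  fixes T :: "'a::euclidean_space \<Rightarrow> 'a"
  assumes c: "c > 0" and T: "\<And>x y. c * dist x y \<le> dist (T x) (T y)"
    and contT: "continuous_on UNIV T" and U: "open U" "bounded U"
  shows "emeasure lborel (T -` U)
    \<le> ennreal (unit_ball_vol DIM('a) * (DIM('a) / c) ^ DIM('a)) * emeasure lborel U"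
    (is "_ \<le> ?C * _")
proof -
  obtain m where m: "m > 0" "U \<subseteq> cbox (- (m *\<^sub>R One)) (m *\<^sub>R One)"
  proof -
    obtain a where a: "U \<subseteq> cbox (-a) a" using bounded_subset_cbox_symmetric[OF U(2)] by auto
    define m where "m = 1 + (\<Sum>i\<in>Basis. \<bar>a \<bullet> i\<bar>)"
    have "\<bar>a \<bullet> i\<bar> \<le> m" if "i \<in> Basis" for i
      using member_le_sum[of i Basis "\<lambda>i. \<bar>a \<bullet> i\<bar>"] that unfolding m_def by simp
    then have "cbox (-a) a \<subseteq> cbox (- (m *\<^sub>R One)) (m *\<^sub>R One)"
      unfolding subset_box(1) by (fastforce simp: abs_le_iff)
    moreover have "m > 0" unfolding m_def by (smt (verit) sum_nonneg abs_ge_zero)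
    ultimately show ?thesis using that a by blast
  qed
  have "\<forall>x. \<exists>e>0. x \<in> U \<longrightarrow> ball x e \<subseteq> U" using U(1) open_contains_ball by (meson zero_less_one)
  then obtain e where e: "\<And>x. e x > 0" "\<And>x. x \<in> U \<Longrightarrow> ball x (e x) \<subseteq> U" by metis
  have gauge: "gauge (\<lambda>x. ball x (e x))" using e by (intro gauge_ball_dependent) auto
  have ne: "box (- (m *\<^sub>R One)) (m *\<^sub>R One :: 'a) \<noteq> {}" using m(1) by (auto simp: box_eq_empty not_le)
  obtain D where D: "countable D"
    "\<And>K. K \<in> D \<Longrightarrow> interior K \<noteq> {} \<and> (\<exists>c d. K = cbox c d)"
    "pairwise (\<lambda>A B. interior A \<inter> interior B = {}) D"
    "\<And>K. K \<in> D \<Longrightarrow> \<exists>x\<in>U \<inter> K. K \<subseteq> ball x (e x)"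
    "\<And>u v. cbox u v \<in> D \<Longrightarrow> \<exists>n::nat. \<forall>i\<in>Basis. v \<bullet> i - u \<bullet> i = ((m *\<^sub>R One) \<bullet> i - (- (m *\<^sub>R One)) \<bullet> i) / 2 ^ n"
    "U \<subseteq> \<Union>D"
    using covering_lemma[OF m(2) ne gauge] by metis
  have TU: "T -` U \<subseteq> (\<Union>K\<in>D. T -` K)" using D(6) by auto
  have meas: "T -` K \<in> sets lborel" if K: "K \<in> D" for K
  proof -
    obtain c d where "K = cbox c d" using D(2)[OF K] by auto
    then show ?thesis
      using measurable_sets_borel[OF borel_measurable_continuous_onI[OF contT], of "cbox c d"] by simp
  qed
  have "emeasure lborel (T -` U) \<le> emeasure lborel (\<Union>K\<in>D. T -` K)"
    using TU meas D(1) by (intro emeasure_mono sets.countable_UN') auto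
  also have "\<dots> \<le> (\<integral>\<^sup>+K. emeasure lborel (T -` K) \<partial>count_space D)"
    using D(1) meas by (intro emeasure_UN_countable_le) auto
  also have "\<dots> \<le> (\<integral>\<^sup>+K. ?C * emeasure lborel (interior K) \<partial>count_space D)"
  proof (rule nn_integral_mono, simp)
    fix K assume K: "K \<in> D"
    then obtain u v where uv: "K = cbox u v" using D(2) by meson
    with K D(5)[of u v] obtain n :: nat where n: "\<forall>i\<in>Basis. v \<bullet> i - u \<bullet> i = ((m *\<^sub>R One) \<bullet> i - (- (m *\<^sub>R One)) \<bullet> i) / 2 ^ n"
      by blast
    have "emeasure lborel (T -` cbox u v) \<le> ?C * emeasure lborel (cbox u v)"
      using n m(1) by (intro emeasure_vimage_expanding_cube[OF c T, of "2 * m / 2 ^ n"]) auto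
    also have "emeasure lborel (cbox u v) = emeasure lborel (interior K)"
      unfolding uv interior_cbox emeasure_lborel_box_eq emeasure_lborel_cbox_eq ..
    finally show "emeasure lborel (T -` K) \<le> ?C * emeasure lborel (interior K)" using uv by simp
  qed
  also have "\<dots> = ?C * (\<integral>\<^sup>+K. emeasure lborel (interior K) \<partial>count_space D)"
    by (rule nn_integral_cmult) simp
  also have "(\<integral>\<^sup>+K. emeasure lborel (interior K) \<partial>count_space D) = emeasure lborel (\<Union>K\<in>D. interior K)"
    using D(1,3) by (intro emeasure_UN_countable[symmetric]) (auto simp: disjoint_family_on_def pairwise_def)
  also have "\<dots> \<le> emeasure lborel U"
    using D(4) e(2) interior_subset U(1) by (intro emeasure_mono) (blast, simp)
  finally show ?thesis by (simp add: mult_left_mono)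
qed

text \<open>A change of variables without a derivative. Outer regularity leads from open to bounded
  Borel sets, and exhaustion by balls to all Borel sets. The resulting inequality says that the
  image of Lebesgue measure under \<open>T\<close> is dominated by a multiple of Lebesgue measure,
  against which \<open>h\<close> is integrated.\<close>

lemma nn_integral_expanding_le:
  fixes T :: "'a::euclidean_space \<Rightarrow> 'a"
  assumes c: "c > 0" and T: "\<And>x y. c * dist x y \<le> dist (T x) (T y)"
    and contT: "continuous_on UNIV T" and h[measurable]: "h \<in> borel_measurable borel"
  shows "(\<integral>\<^sup>+x. h (T x) \<partial>lborel)
    \<le> ennreal (unit_ball_vol DIM('a) * (DIM('a) / c) ^ DIM('a)) * (\<integral>\<^sup>+x. h x \<partial>lborel)"
    (is "_ \<le> ?C * _")
proof -
  have [measurable]: "T \<in> borel_measurable borel" using contT by (rule borel_measurable_continuous_onI)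
  have bdd: "emeasure lborel (T -` A) \<le> ?C * emeasure lborel A" if A[measurable]: "A \<in> sets borel" "bounded A" for A
  proof (rule ennreal_le_epsilon)
    fix e :: real assume e: "e > 0"
    define k where "k = unit_ball_vol DIM('a) * (DIM('a) / c) ^ DIM('a)"
    have k: "k > 0" unfolding k_def using c by simp
    obtain U where U: "open U" "A \<subseteq> U" "emeasure lborel (U - A) < ennreal (e / k)"
      using outer_regular_lborel[OF A(1), of "e / k"] e k by auto
    obtain B where B: "A \<subseteq> ball 0 B" using A(2) bounded_subset_ballD by blast
    define V where "V = U \<inter> ball 0 B"
    have V[measurable]: "open V" "bounded V" "A \<subseteq> V" unfolding V_def using U B by auto
    have "emeasure lborel (T -` A) \<le> emeasure lborel (T -` V)"
      using V(3) by (intro emeasure_mono) (auto intro!: measurable_sets_borel[of T borel])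
    also have "\<dots> \<le> ?C * emeasure lborel V"
      by (rule emeasure_vimage_expanding_open[OF c T contT V(1,2)])
    also have "emeasure lborel V = emeasure lborel A + emeasure lborel (V - A)"
      using V by (subst plus_emeasure) (auto simp: Un_absorb1)
    also have "emeasure lborel (V - A) \<le> emeasure lborel (U - A)"
      using U by (intro emeasure_mono) (auto simp: V_def)
    also have "\<dots> \<le> ennreal (e / k)" using U(3) by simp
    also have "?C * (emeasure lborel A + ennreal (e / k)) = ?C * emeasure lborel A + ennreal e"
      using k e unfolding k_def[symmetric] by (simp add: distrib_left ennreal_mult[symmetric])
    finally show "emeasure lborel (T -` A) \<le> ?C * emeasure lborel A + ennreal e"
      by (simp add: add_left_mono mult_left_mono)
  qed
  have all: "emeasure lborel (T -` A) \<le> ?C * emeasure lborel A" if A[measurable]: "A \<in> sets borel" for A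
  proof -
    have [measurable]: "T -` (A \<inter> ball 0 (real n)) \<in> sets borel" for n
      by (rule measurable_sets_borel[of T borel]) auto
    note [simp del] = vimage_Int
    have eq: "T -` A = (\<Union>n. T -` (A \<inter> ball 0 (real n)))"
      using reals_Archimedean2 by auto
    have "emeasure lborel (T -` A) = (SUP n. emeasure lborel (T -` (A \<inter> ball 0 (real n))))"
      unfolding eq by (rule SUP_emeasure_incseq[symmetric]) (auto simp: incseq_def)
    also have "\<dots> \<le> ?C * emeasure lborel A"
    proof (rule SUP_least)
      fix n
      have "emeasure lborel (T -` (A \<inter> ball 0 (real n))) \<le> ?C * emeasure lborel (A \<inter> ball 0 (real n))"
        by (rule bdd) auto
      also have "\<dots> \<le> ?C * emeasure lborel A" by (intro mult_left_mono emeasure_mono) auto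
      finally show "emeasure lborel (T -` (A \<inter> ball 0 (real n))) \<le> ?C * emeasure lborel A" .
    qed
    finally show ?thesis .
  qed
  have "(\<integral>\<^sup>+x. h (T x) \<partial>lborel) = (\<integral>\<^sup>+x. h x \<partial>distr lborel borel T)"
    by (rule nn_integral_distr[symmetric]) auto
  also have "\<dots> \<le> (\<integral>\<^sup>+x. h x \<partial>density lborel (\<lambda>_. ?C))"
  proof (rule nn_integral_mono_measure)
    show "distr lborel borel T \<le> density lborel (\<lambda>_. ?C)"
      by (subst le_measure) (auto simp: le_fun_def emeasure_distr emeasure_density_const all emeasure_notin_sets)
  qed auto
  also have "\<dots> = ?C * (\<integral>\<^sup>+x. h x \<partial>lborel)"
    by (subst nn_integral_density) (auto intro: nn_integral_cmult)
  finally show ?thesis .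
qed

section \<open>Power inequalities and the truncated kernel\<close>

lemma powr_add_le:
  fixes x y p :: real
  assumes "0 \<le> x" "0 \<le> y" "0 \<le> p"
  shows "(x + y) powr p \<le> 2 powr p * (x powr p + y powr p)"
proof -
  have "(x + y) powr p \<le> (2 * max x y) powr p"
    using assms by (intro powr_mono2) auto
  also have "\<dots> = 2 powr p * max x y powr p" using assms by (simp add: powr_mult)
  also have "max x y powr p \<le> x powr p + y powr p" by (auto simp: max_def)
  finally show ?thesis by simp
qed

text \<open>The tangent line of the convex function t^p at \<open>a\<close>. Young's inequality for
  \<open>t\<close> and \<open>a powr (p - 1)\<close> with exponents p and p / (p - 1) gives it
  without derivatives.\<close>

lemma powr_tangent_le:
  fixes a t p :: real
  assumes "1 < p" "0 < a" "0 \<le> t"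
  shows "a powr p + p * a powr (p - 1) * (t - a) \<le> t powr p"
proof -
  have "t * a powr (p - 1) \<le> t powr p / p + (a powr (p - 1)) powr (p / (p - 1)) / (p / (p - 1))"
    using assms by (intro Youngs_inequality) (auto simp: field_simps)
  also have "(a powr (p - 1)) powr (p / (p - 1)) = a powr p"
    using assms by (simp add: powr_powr)
  finally have "p * (t * a powr (p - 1)) \<le> t powr p + (p - 1) * a powr p"
    using assms by (simp add: field_simps)
  moreover have "a powr (p - 1) * a = a powr p"
    using assms by (simp add: powr_mult_base mult.commute)
  ultimately show ?thesis by (simp add: algebra_simps)
qed

text \<open>Jensen's inequality, by integrating the tangent line at \<open>a = |E X|\<close>
  evaluated at |X|; as E|X| is at least \<open>a\<close>, the linear term has the favourable sign.
  The right-hand side is an extended integral because |X|^p may fail to be integrable.\<close>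

lemma (in prob_space) abs_expectation_powr_le:
  fixes X :: "'a \<Rightarrow> real"
  assumes p: "1 < p" and X: "integrable M X"
  shows "ennreal (\<bar>expectation X\<bar> powr p) \<le> (\<integral>\<^sup>+\<omega>. ennreal (\<bar>X \<omega>\<bar> powr p) \<partial>M)"
proof (cases "expectation X = 0 \<or> (\<integral>\<^sup>+\<omega>. ennreal (\<bar>X \<omega>\<bar> powr p) \<partial>M) = \<infinity>")
  case False
  define a where "a = \<bar>expectation X\<bar>"
  have a: "a > 0" using False by (simp add: a_def)
  have [measurable]: "X \<in> borel_measurable M" using X by simp
  have int: "integrable M (\<lambda>\<omega>. \<bar>X \<omega>\<bar> powr p)"
    using False by (intro integrableI_nonneg) (auto simp: less_top)
  have "a powr p \<le> a powr p + p * a powr (p - 1) * (expectation (\<lambda>\<omega>. \<bar>X \<omega>\<bar>) - a)"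
    using p integral_abs_bound[of M X] unfolding a_def by (simp add: mult_nonneg_nonneg)
  also have "\<dots> = expectation (\<lambda>\<omega>. a powr p + p * a powr (p - 1) * (\<bar>X \<omega>\<bar> - a))"
    using X by (simp add: prob_space)
  also have "\<dots> \<le> expectation (\<lambda>\<omega>. \<bar>X \<omega>\<bar> powr p)"
    using X int powr_tangent_le[OF p a] by (intro integral_mono) auto
  finally show ?thesis
    unfolding a_def using int by (simp add: nn_integral_eq_integral ennreal_leI)
qed (use p in auto)

section \<open>The fractional kernel truncated at a scale\<close>

lemma dyadic_scale:
  fixes r t :: real
  assumes "0 < t" "t \<le> r"
  obtains j :: nat where "2 ^ j * t \<le> r" "r < 2 ^ Suc j * t"
proof -
  define j where "j = (LEAST j. r < 2 ^ Suc j * t)"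
  have "\<exists>j. r < 2 ^ Suc j * t"
  proof -
    obtain k where "r / t < 2 ^ k" using real_arch_pow[of 2 "r / t"] by auto
    then have "r < 2 ^ Suc k * t" using assms by (simp add: field_simps)
    then show ?thesis ..
  qed
  then have j: "r < 2 ^ Suc j * t" unfolding j_def by (rule LeastI_ex)
  have "2 ^ j * t \<le> r"
  proof (cases j)
    case (Suc i)
    then have "\<not> r < 2 ^ Suc i * t" unfolding j_def using not_less_Least by (metis lessI)
    then show ?thesis using Suc by simp
  qed (use assms in simp)
  with j that show thesis by blast
qed

text \<open>
  Both the far part and, since \<open>p > \<alpha>\<close>, the near part are summed over dyadic annuli.
\<close>

lemma nn_integral_truncated_kernel_le:
  fixes \<alpha> p :: real
  assumes \<alpha>: "0 < \<alpha>" "\<alpha> < p"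
  shows "\<exists>C>0. \<forall>t>0. \<forall>x::'a::euclidean_space.
    (\<integral>\<^sup>+y. ennreal (min 1 (norm (x - y) / t) powr p / norm (x - y) powr (DIM('a) + \<alpha>)) \<partial>lborel)
      \<le> ennreal (C * t powr - \<alpha>)"
proof -
  define n where "n = real DIM('a)"
  define \<omega> where "\<omega> = unit_ball_vol n"
  have \<omega>: "\<omega> > 0" unfolding \<omega>_def n_def by simp
  have n0: "n > 0" unfolding n_def by simp
  \<comment> \<open>Sums of geometric series over annuli: the ratio is 2^(-\<alpha>) beyond distance
    t and 2^(\<alpha> - p) below it. The factor 2^n pays for the outer radius of a far annulus, 2^(n
    + \<alpha>) for the inner radius of a near one.\<close>
  define C1 where "C1 = \<omega> * 2 powr n / (1 - 2 powr - \<alpha>)"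
  define C2 where "C2 = \<omega> * 2 powr (n + \<alpha>) / (1 - 2 powr (\<alpha> - p))"
  have q1: "0 < 2 powr - \<alpha>" "2 powr - \<alpha> < (1::real)" using \<alpha> by (auto simp: powr_less_one)
  have q2: "0 < 2 powr (\<alpha> - p)" "2 powr (\<alpha> - p) < (1::real)" using \<alpha> by (auto simp: powr_less_one)
  have C: "C1 > 0" "C2 > 0" unfolding C1_def C2_def using \<omega> q1 q2 by auto
  have main: "(\<integral>\<^sup>+y. ennreal (min 1 (norm (x - y) / t) powr p / norm (x - y) powr (n + \<alpha>)) \<partial>lborel)
      \<le> ennreal ((C1 + C2) * t powr - \<alpha>)" if t: "t > 0" for t and x :: 'a
  proof -
    define a where "a j = (2 ^ j * t) powr - (n + \<alpha>)" for j :: nat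
    define b where "b j = (1 / 2 ^ j) powr p * (t / 2 ^ Suc j) powr - (n + \<alpha>)" for j :: nat
    define A where "A j y = ennreal (a j) * indicator (ball x (2 ^ Suc j * t)) y" for j y
    define B where "B j y = ennreal (b j) * indicator (ball x (t / 2 ^ j)) y" for j y
    have [measurable]: "A j \<in> borel_measurable borel" "B j \<in> borel_measurable borel" for j
      unfolding A_def B_def by (auto intro!: borel_measurable_times_ennreal borel_measurable_indicator simp del: power_Suc)
    have ball: "emeasure lborel (ball x r) = ennreal (\<omega> * r powr n)" if "r > 0" for r
      using that by (subst emeasure_ball) (auto simp: \<omega>_def n_def powr_realpow)
    have two: "(2::real) ^ j = 2 powr real j" for j by (simp add: powr_realpow)
    have pw: "ennreal (min 1 (norm (x - y) / t) powr p / norm (x - y) powr (n + \<alpha>)) \<le> (\<Sum>j. A j y) + (\<Sum>j. B j y)" for y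
    proof -
      define r where "r = norm (x - y)"
      consider "r = 0" | "t \<le> r" | "0 < r" "r < t" unfolding r_def by force
      then show ?thesis
      proof cases
        case 1 then show ?thesis unfolding r_def by simp
      next
        case 2
        obtain j where j: "2 ^ j * t \<le> r" "r < 2 ^ Suc j * t" using dyadic_scale[OF t 2] .
        have "min 1 (r / t) powr p / r powr (n + \<alpha>) = r powr - (n + \<alpha>)"
          unfolding powr_minus_divide using 2 t by (simp add: min_def field_simps)
        also have "\<dots> \<le> a j" unfolding a_def
          using j t n0 \<alpha> by (intro powr_mono2') auto
        finally have "ennreal (min 1 (r / t) powr p / r powr (n + \<alpha>)) \<le> A j y"
          unfolding A_def using j(2) by (auto simp: r_def dist_norm ennreal_leI)
        also have "\<dots> \<le> (\<Sum>j. A j y)" using sum_le_suminf[of "\<lambda>j. A j y" "{j}"] by simp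
        finally show ?thesis unfolding r_def by (simp add: add_increasing2)
      next
        case 3
        obtain j where j: "2 ^ j * r \<le> t" "t < 2 ^ Suc j * r" using dyadic_scale[of r t] 3 by auto
        \<comment> \<open>The ball in \<open>B j'\<close> is open, so r < t / 2^j' must be strict.
          If 2^j * r equals t the index is lowered by one, which is possible because r < t then
          forces j > 0.\<close>
        define j' where "j' = (if 2 ^ j * r < t then j else j - 1)"
        have j': "r < t / 2 ^ j'" "t / 2 ^ Suc j' \<le> r"
        proof -
          have "j > 0" if "2 ^ j * r = t" using that 3 by (cases j) auto
          then have "r < t / 2 ^ j' \<and> t / 2 ^ Suc j' \<le> r"
            using j 3 unfolding j'_def by (cases j) (auto simp: field_simps)
          then show "r < t / 2 ^ j'" "t / 2 ^ Suc j' \<le> r" by auto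
        qed
        have "min 1 (r / t) powr p / r powr (n + \<alpha>) = (r / t) powr p * r powr - (n + \<alpha>)"
          unfolding powr_minus_divide using 3 t by (simp add: min_def field_simps)
        also have "\<dots> \<le> b j'" unfolding b_def
          using j' 3 t n0 \<alpha> by (intro mult_mono powr_mono2' powr_mono2) (auto simp: field_simps)
        finally have "ennreal (min 1 (r / t) powr p / r powr (n + \<alpha>)) \<le> B j' y"
          unfolding B_def using j' by (auto simp: r_def dist_norm ennreal_leI)
        also have "\<dots> \<le> (\<Sum>j. B j y)" using sum_le_suminf[of "\<lambda>j. B j y" "{j'}"] by simp
        finally show ?thesis unfolding r_def by (simp add: add_increasing)
      qed
    qed
    have IA: "(\<integral>\<^sup>+y. A j y \<partial>lborel) = ennreal (\<omega> * 2 powr n * t powr - \<alpha> * (2 powr - \<alpha>) ^ j)" for j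
    proof -
      have "a j * (\<omega> * (2 ^ Suc j * t) powr n) = \<omega> * 2 powr n * t powr - \<alpha> * (2 powr - \<alpha>) ^ j"
        unfolding a_def two using t
        by (simp add: powr_mult powr_powr powr_add powr_minus powr_diff powr_realpow[symmetric] field_simps)
      moreover have "a j \<ge> 0" unfolding a_def by simp
      moreover have "(\<integral>\<^sup>+y. A j y \<partial>lborel) = ennreal (a j) * ennreal (\<omega> * (2 ^ Suc j * t) powr n)"
        unfolding A_def using ball[of "2 ^ Suc j * t"] t
        by (subst nn_integral_cmult_indicator) (auto simp del: power_Suc)
      ultimately show ?thesis using \<omega> by (simp add: ennreal_mult[symmetric] del: power_Suc)
    qed
    have IB: "(\<integral>\<^sup>+y. B j y \<partial>lborel) = ennreal (\<omega> * 2 powr (n + \<alpha>) * t powr - \<alpha> * (2 powr (\<alpha> - p)) ^ j)" for j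
    proof -
      have "b j * (\<omega> * (t / 2 ^ j) powr n) = \<omega> * 2 powr (n + \<alpha>) * t powr - \<alpha> * (2 powr (\<alpha> - p)) ^ j"
        unfolding b_def two using t
        by (simp add: powr_mult powr_divide powr_powr powr_add powr_minus powr_diff powr_realpow[symmetric] field_simps)
      moreover have "b j \<ge> 0" unfolding b_def by simp
      moreover have "(\<integral>\<^sup>+y. B j y \<partial>lborel) = ennreal (b j) * ennreal (\<omega> * (t / 2 ^ j) powr n)"
        unfolding B_def using ball[of "t / 2 ^ j"] t
        by (subst nn_integral_cmult_indicator) auto
      ultimately show ?thesis using \<omega> by (simp add: ennreal_mult[symmetric])
    qed
    have geo: "(\<Sum>j. ennreal (c * q ^ j)) = ennreal (c / (1 - q))" if "0 \<le> c" "0 < q" "q < 1" for c q :: real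
      using that sums_mult[OF geometric_sums[of q], of c]
      by (subst suminf_ennreal2) (auto simp: sums_iff intro!: arg_cong[where f=ennreal])
    have "(\<integral>\<^sup>+y. ennreal (min 1 (norm (x - y) / t) powr p / norm (x - y) powr (n + \<alpha>)) \<partial>lborel)
        \<le> (\<integral>\<^sup>+y. (\<Sum>j. A j y) + (\<Sum>j. B j y) \<partial>lborel)"
      by (intro nn_integral_mono pw)
    also have "\<dots> = (\<Sum>j. \<integral>\<^sup>+y. A j y \<partial>lborel) + (\<Sum>j. \<integral>\<^sup>+y. B j y \<partial>lborel)"
      by (simp add: nn_integral_add nn_integral_suminf)
    also have "\<dots> = ennreal (C1 * t powr - \<alpha>) + ennreal (C2 * t powr - \<alpha>)"
    proof -
      have "\<omega> * 2 powr n * t powr - \<alpha> \<ge> 0" "\<omega> * 2 powr (n + \<alpha>) * t powr - \<alpha> \<ge> 0"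
        using \<omega> by auto
      then show ?thesis
        unfolding IA IB C1_def C2_def by (simp only: geo q1 q2) (simp add: mult_ac)
    qed
    also have "\<dots> = ennreal ((C1 + C2) * t powr - \<alpha>)"
      using C by (simp add: ennreal_plus[symmetric] algebra_simps del: ennreal_plus)
    finally show ?thesis .
  qed
  show ?thesis using main C unfolding n_def by (intro exI[of _ "C1 + C2"]) auto
qed

section \<open>Energies, capacities and the Hardy integral\<close>

lemma frontier_nonempty_of_proper:
  fixes G :: "'a::real_normed_vector set"
  shows "G \<noteq> {} \<Longrightarrow> G \<noteq> UNIV \<Longrightarrow> frontier G \<noteq> {}"
  by (simp add: frontier_eq_empty)

lemma infdist_frontier_pos:
  fixes G :: "'a::real_normed_vector set"
  assumes "open G" "G \<noteq> UNIV" "x \<in> G"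
  shows "0 < infdist x (frontier G)"
proof -
  have "x \<notin> frontier G" using assms(1,3) by (simp add: frontier_def interior_open)
  then show ?thesis
    using assms frontier_nonempty_of_proper[of G] infdist_pos_not_in_closed[OF frontier_closed] by auto
qed

text \<open>The segment from \<open>x\<close> to \<open>y\<close> leaves \<open>G\<close> and so
  meets the frontier; the meeting point splits its length into two parts, which bound the two
  distances separately.\<close>

lemma infdist_frontier_add_le_dist:
  fixes G :: "'a::euclidean_space set"
  assumes "x \<in> G" "y \<notin> G"
  shows "infdist x (frontier G) + infdist y (frontier G) \<le> dist x y"
proof -
  have "closed_segment x y \<inter> frontier G \<noteq> {}"
    using assms by (intro connected_Int_frontier) auto
  then obtain z where z: "z \<in> closed_segment x y" "z \<in> frontier G" by auto
  then have "dist x y = dist x z + dist z y" using between between_mem_segment by metis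
  with z(2) show ?thesis
    by (metis add_mono dist_commute infdist_le)
qed

lemma infdist_frontier_le_dist:
  fixes G :: "'a::euclidean_space set"
  assumes "x \<in> G" "y \<notin> G"
  shows "infdist x (frontier G) \<le> dist x y"
  using infdist_frontier_add_le_dist[OF assms] infdist_nonneg[of y "frontier G"] by simp

text \<open>\<open>G\<close> and the complement of the closed support are open and cover the space.
  The extension is continuous on the first and vanishes on the second.\<close>

lemma continuous_on_zero_ext:
  fixes G :: "'a::t2_space set"
  assumes G: "open G" and u: "u \<in> compactly_supported G"
  shows "continuous_on UNIV (zero_ext G u)"
proof -
  let ?S = "closure {x\<in>G. u x \<noteq> 0}"
  have "continuous_on G (zero_ext G u) \<longleftrightarrow> continuous_on G u"
    by (rule continuous_on_cong) (auto simp: zero_ext_def)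
  then have 1: "continuous_on G (zero_ext G u)" using u by (simp add: compactly_supported_def)
  have z: "zero_ext G u x = 0" if "x \<in> - ?S" for x
    using that closure_subset[of "{x\<in>G. u x \<noteq> 0}"] by (auto simp: zero_ext_def)
  then have 2: "continuous_on (- ?S) (zero_ext G u)"
    by (metis (mono_tags, lifting) continuous_on_cong continuous_on_const)
  have "G \<union> - ?S = UNIV" using u by (auto simp: compactly_supported_def)
  then show ?thesis using continuous_on_open_Un[OF G _ 1 2] by (simp add: open_Compl)
qed

lemma compactly_supported_subset:
  fixes G :: "'a::t2_space set"
  assumes "u \<in> compactly_supported G" "continuous_on G v" "\<And>x. x \<in> G \<Longrightarrow> u x = 0 \<Longrightarrow> v x = 0"
  shows "v \<in> compactly_supported G"
proof -
  have "closure {x\<in>G. v x \<noteq> 0} \<subseteq> closure {x\<in>G. u x \<noteq> 0}"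
    using assms(3) by (intro closure_mono) auto
  moreover from this have "compact (closure {x\<in>G. v x \<noteq> 0})"
    using assms(1) closed_Int_compact[OF closed_closure] unfolding compactly_supported_def
    by (metis (no_types, lifting) Int_absorb2 mem_Collect_eq)
  ultimately show ?thesis using assms(1,2) unfolding compactly_supported_def by blast
qed

definition gagliardo_integrand ::
    "real \<Rightarrow> real \<Rightarrow> (real^'n \<Rightarrow> real) \<Rightarrow> real^'n \<Rightarrow> real^'n \<Rightarrow> ennreal" where
  "gagliardo_integrand s p u x y =
     ennreal (\<bar>u x - u y\<bar> powr p / norm (x - y) powr (real CARD('n) + s * p))"

lemma gagliardo_energy_eq:
  "gagliardo_energy s p G u = (\<integral>\<^sup>+x\<in>G. (\<integral>\<^sup>+y\<in>G. gagliardo_integrand s p u x y \<partial>lborel) \<partial>lborel)"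
  by (simp add: gagliardo_energy_def gagliardo_integrand_def)

lemma gagliardo_energy_cong:
  assumes "\<And>x. x \<in> G \<Longrightarrow> u x = v x"
  shows "gagliardo_energy s p G u = gagliardo_energy s p G v"
  unfolding gagliardo_energy_eq
  by (intro nn_integral_cong) (auto simp: indicator_def gagliardo_integrand_def assms intro!: nn_integral_cong)

lemma gagliardo_energy_zero_ext: "gagliardo_energy s p G (zero_ext G u) = gagliardo_energy s p G u"
  by (rule gagliardo_energy_cong) (simp add: zero_ext_def)

lemma measurable_gagliardo_integrand [measurable]:
  fixes u :: "real^'n \<Rightarrow> real"
  assumes [measurable]: "u \<in> borel_measurable borel" "g \<in> borel_measurable M" "h \<in> borel_measurable M"
  shows "(\<lambda>w. gagliardo_integrand s p u (g w) (h w)) \<in> borel_measurable M"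
  unfolding gagliardo_integrand_def by measurable

lemma gagliardo_integrand_commute: "gagliardo_integrand s p u x y = gagliardo_integrand s p u y x"
  by (simp add: gagliardo_integrand_def norm_minus_commute abs_minus_commute)

lemma capacity_eq:
  "0 < p \<Longrightarrow> capacity s p K G = (INF u\<in>{u \<in> compactly_supported G. \<forall>x\<in>K. u x \<ge> 1}. gagliardo_energy s p G u)"
  by (simp add: capacity_def gagliardo_seminorm_powr)

lemma capacity_le:
  "0 < p \<Longrightarrow> u \<in> compactly_supported G \<Longrightarrow> (\<And>x. x \<in> K \<Longrightarrow> u x \<ge> 1) \<Longrightarrow>
    capacity s p K G \<le> gagliardo_energy s p G u"
  unfolding capacity_eq by (rule INF_lower) auto

lemma le_capacityI:
  assumes "0 < p" "0 < N"
    and "\<And>u. u \<in> compactly_supported G \<Longrightarrow> (\<And>x. x \<in> K \<Longrightarrow> u x \<ge> 1) \<Longrightarrow>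
      X \<le> ennreal N * gagliardo_energy s p G u"
  shows "X \<le> ennreal N * capacity s p K G"
proof -
  have "ennreal (1 / N) * X \<le> capacity s p K G"
    unfolding capacity_eq[OF assms(1)]
  proof (rule INF_greatest)
    fix u assume "u \<in> {u \<in> compactly_supported G. \<forall>x\<in>K. u x \<ge> 1}"
    then have "ennreal (1 / N) * X \<le> ennreal (1 / N) * (ennreal N * gagliardo_energy s p G u)"
      using assms(3) by (intro mult_left_mono) auto
    also have "\<dots> = gagliardo_energy s p G u"
      using assms(2) by (simp add: mult.assoc[symmetric] ennreal_mult[symmetric])
    finally show "ennreal (1 / N) * X \<le> gagliardo_energy s p G u" .
  qed
  then have "ennreal N * (ennreal (1 / N) * X) \<le> ennreal N * capacity s p K G"
    by (intro mult_left_mono) auto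
  then show ?thesis using assms(2) by (simp add: mult.assoc[symmetric] ennreal_mult[symmetric])
qed

definition hardy_integral :: "real \<Rightarrow> real \<Rightarrow> (real^'n) set \<Rightarrow> (real^'n \<Rightarrow> real) \<Rightarrow> ennreal" where
  "hardy_integral s p G u =
     (\<integral>\<^sup>+x\<in>G. ennreal (\<bar>u x\<bar> powr p * infdist x (frontier G) powr (- (s * p))) \<partial>lborel)"

lemma hardy_integral_cong:
  assumes "\<And>x. x \<in> G \<Longrightarrow> u x = v x"
  shows "hardy_integral s p G u = hardy_integral s p G v"
  unfolding hardy_integral_def by (intro nn_integral_cong) (auto simp: indicator_def assms)

lemma hardy_integral_zero_ext: "hardy_integral s p G (zero_ext G u) = hardy_integral s p G u"
  by (rule hardy_integral_cong) (simp add: zero_ext_def)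

lemma hardy_inequality_iff:
  "0 < p \<Longrightarrow> hardy_inequality s p G \<longleftrightarrow>
    (\<exists>C>0. \<forall>u\<in>compactly_supported G. hardy_integral s p G u \<le> ennreal C * gagliardo_energy s p G u)"
  by (simp add: hardy_inequality_def hardy_integral_def gagliardo_seminorm_powr)

text \<open>The fractional kernel truncated at the scale d(x) / L and weighted by |u(x)|^p. The
  factor \<open>L\<close> is 1 for pairs of points separated by the boundary and a larger constant
  for differences of cutoffs.\<close>

definition hardy_kernel :: "real \<Rightarrow> real \<Rightarrow> real \<Rightarrow> (real^'n) set \<Rightarrow> (real^'n \<Rightarrow> real) \<Rightarrow> real^'n \<Rightarrow> real^'n \<Rightarrow> ennreal"
  where "hardy_kernel L s p G u x y =
    ennreal (\<bar>u x\<bar> powr p * (min 1 (norm (x - y) / (infdist x (frontier G) / L)) powr p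
      / norm (x - y) powr (real CARD('n) + s * p)))"

lemma measurable_hardy_kernel [measurable]:
  fixes u :: "real^'n \<Rightarrow> real"
  assumes [measurable]: "u \<in> borel_measurable borel" "g \<in> borel_measurable M" "h \<in> borel_measurable M"
  shows "(\<lambda>w. hardy_kernel L s p G u (g w) (h w)) \<in> borel_measurable M"
proof -
  have [measurable]: "(\<lambda>x. infdist x (frontier G)) \<in> borel_measurable borel"
    by (intro borel_measurable_continuous_onI continuous_intros)
  show ?thesis unfolding hardy_kernel_def by measurable
qed

text \<open>For fixed \<open>x\<close> in \<open>G\<close>, the truncated kernel with \<alpha> = sp
  and t = d(x) / L integrates to a multiple of d(x)^(-sp), the weight of the Hardy integral; s < 1
  ensures \<alpha> < p. The constant is uniform in \<open>G\<close> and \<open>u\<close>.\<close>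

lemma nn_integral_hardy_kernel_le:
  fixes s p L :: real
  assumes "0 < s" "s < 1" "1 < p" "0 < L"
  shows "\<exists>K>0. \<forall>(G :: (real^'n) set) u. open G \<and> G \<noteq> UNIV \<and> u \<in> borel_measurable borel \<longrightarrow>
    (\<integral>\<^sup>+x\<in>G. (\<integral>\<^sup>+y. hardy_kernel L s p G u x y \<partial>lborel) \<partial>lborel) \<le> ennreal K * hardy_integral s p G u"
proof -
  have sp: "0 < s * p" "s * p < p" using assms by auto
  obtain K where K: "K > 0" "\<And>t (x::real^'n). t > 0 \<Longrightarrow>
      (\<integral>\<^sup>+y. ennreal (min 1 (norm (x - y) / t) powr p / norm (x - y) powr (CARD('n) + s * p)) \<partial>lborel)
      \<le> ennreal (K * t powr - (s * p))"
    using nn_integral_truncated_kernel_le[OF sp, where 'a = "real^'n"] by auto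
  have main: "(\<integral>\<^sup>+x\<in>G. (\<integral>\<^sup>+y. hardy_kernel L s p G u x y \<partial>lborel) \<partial>lborel)
      \<le> ennreal (K * L powr (s * p)) * hardy_integral s p G u"
    if G: "open G" "G \<noteq> UNIV" and [measurable]: "u \<in> borel_measurable borel" for G :: "(real^'n) set" and u
  proof -
    have [measurable]: "(\<lambda>x. infdist x (frontier G)) \<in> borel_measurable borel"
      by (intro borel_measurable_continuous_onI continuous_intros)
    have [measurable]: "G \<in> sets borel" using G(1) by simp
    have "(\<integral>\<^sup>+x\<in>G. (\<integral>\<^sup>+y. hardy_kernel L s p G u x y \<partial>lborel) \<partial>lborel)
      \<le> (\<integral>\<^sup>+x. ennreal (K * L powr (s * p)) * (ennreal (\<bar>u x\<bar> powr p * infdist x (frontier G) powr (- (s * p))) * indicator G x) \<partial>lborel)"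
    proof (rule nn_integral_mono)
      fix x
      let ?d = "infdist x (frontier G)"
      show "(\<integral>\<^sup>+y. hardy_kernel L s p G u x y \<partial>lborel) * indicator G x
        \<le> ennreal (K * L powr (s * p)) * (ennreal (\<bar>u x\<bar> powr p * ?d powr (- (s * p))) * indicator G x)"
      proof (cases "x \<in> G")
        case True
        have d: "?d > 0" using infdist_frontier_pos[OF G True] .
        have "(\<integral>\<^sup>+y. hardy_kernel L s p G u x y \<partial>lborel) = ennreal (\<bar>u x\<bar> powr p) *
            (\<integral>\<^sup>+y. ennreal (min 1 (norm (x - y) / (?d / L)) powr p / norm (x - y) powr (CARD('n) + s * p)) \<partial>lborel)"
          unfolding hardy_kernel_def
          by (subst nn_integral_cmult[symmetric]) (auto simp: ennreal_mult' simp del: times_divide_eq_right)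
        also have "\<dots> \<le> ennreal (\<bar>u x\<bar> powr p) * ennreal (K * (?d / L) powr - (s * p))"
          using d assms by (intro mult_left_mono K(2)) auto
        also have "\<dots> = ennreal (K * L powr (s * p)) * (ennreal (\<bar>u x\<bar> powr p * ?d powr (- (s * p))))"
          using K(1) d assms by (subst (1 2) ennreal_mult[symmetric])
            (auto simp: powr_divide powr_minus field_simps)
        finally show ?thesis using True by simp
      qed simp
    qed
    also have "\<dots> = ennreal (K * L powr (s * p)) * hardy_integral s p G u"
      unfolding hardy_integral_def by (subst nn_integral_cmult) auto
    finally show ?thesis .
  qed
  show ?thesis using K(1) assms main by (intro exI[of _ "K * L powr (s * p)"]) auto
qed

section \<open>From Hardy's inequality to the zero extension\<close>

lemma ennreal_powr_mono: "0 \<le> r \<Longrightarrow> a \<le> b \<Longrightarrow> ennreal_powr a r \<le> ennreal_powr b r"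
  unfolding ennreal_powr_def
  by (auto simp: top_unique less_top intro!: ennreal_leI powr_mono2 enn2real_mono)

lemma ennreal_powr_cmult:
  "0 < C \<Longrightarrow> ennreal_powr (ennreal C * a) r = ennreal (C powr r) * ennreal_powr a r"
  by (auto simp: ennreal_powr_def ennreal_mult_eq_top_iff ennreal_mult_top enn2real_mult powr_mult ennreal_mult)

lemma admits_zero_extension_iff:
  fixes G :: "(real^'n) set"
  assumes p: "0 < p"
  shows "admits_zero_extension s p G \<longleftrightarrow>
    (\<exists>C>0. \<forall>u\<in>compactly_supported G.
        gagliardo_energy s p UNIV (zero_ext G u) \<le> ennreal C * gagliardo_energy s p G u)"
proof
  assume "admits_zero_extension s p G"
  then obtain C where C: "C > 0" "\<And>u. u \<in> compactly_supported G \<Longrightarrow>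
      gagliardo_seminorm s p UNIV (zero_ext G u) \<le> ennreal C * gagliardo_seminorm s p G u"
    unfolding admits_zero_extension_def by auto
  have "gagliardo_energy s p UNIV (zero_ext G u) \<le> ennreal (C powr p) * gagliardo_energy s p G u"
    if "u \<in> compactly_supported G" for u
    using ennreal_powr_mono[OF _ C(2)[OF that], of p] p C(1)
    by (simp add: ennreal_powr_cmult gagliardo_seminorm_powr)
  then show "\<exists>C>0. \<forall>u\<in>compactly_supported G.
        gagliardo_energy s p UNIV (zero_ext G u) \<le> ennreal C * gagliardo_energy s p G u"
    using C(1) by (intro exI[of _ "C powr p"]) auto
next
  assume "\<exists>C>0. \<forall>u\<in>compactly_supported G.
        gagliardo_energy s p UNIV (zero_ext G u) \<le> ennreal C * gagliardo_energy s p G u"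
  then obtain C where C: "C > 0" "\<And>u. u \<in> compactly_supported G \<Longrightarrow>
      gagliardo_energy s p UNIV (zero_ext G u) \<le> ennreal C * gagliardo_energy s p G u"
    by auto
  have "gagliardo_seminorm s p UNIV (zero_ext G u) \<le> ennreal (C powr (1 / p)) * gagliardo_seminorm s p G u"
    if "u \<in> compactly_supported G" for u
    using ennreal_powr_mono[OF _ C(2)[OF that], of "1 / p"] p C(1)
    by (simp add: ennreal_powr_cmult gagliardo_seminorm_def)
  then show "admits_zero_extension s p G" unfolding admits_zero_extension_def
    using C(1) by (intro exI[of _ "C powr (1 / p)"]) auto
qed

text \<open>Pairs of points are split by membership in \<open>G\<close>. Inner pairs give the energy
  on \<open>G\<close> and outer pairs give nothing. The points of a mixed pair are at least d(x)
  apart, with \<open>x\<close> the inner one, so there the integrand agrees with the truncated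
  kernel for L = 1 and is bounded by a Hardy integral.\<close>

lemma hardy_imp_zero_extension:
  fixes G :: "(real^'n) set"
  assumes sp: "0 < s" "s < 1" "1 < p" and G: "open G" "G \<noteq> UNIV"
    and H: "hardy_inequality s p G"
  shows "admits_zero_extension s p G"
proof -
  have p0: "0 < p" using sp by simp
  obtain C where C: "C > 0" "\<And>u. u \<in> compactly_supported G \<Longrightarrow>
      hardy_integral s p G u \<le> ennreal C * gagliardo_energy s p G u"
    using H unfolding hardy_inequality_iff[OF p0] by auto
  obtain K where K: "K > 0" "\<And>u. u \<in> borel_measurable borel \<Longrightarrow>
      (\<integral>\<^sup>+x\<in>G. (\<integral>\<^sup>+y. hardy_kernel 1 s p G u x y \<partial>lborel) \<partial>lborel) \<le> ennreal K * hardy_integral s p G u"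
    using nn_integral_hardy_kernel_le[OF sp, of 1, where 'n='n] G by auto
  have [measurable]: "G \<in> sets borel" using G(1) by simp
  \<comment> \<open>The summand 1 is the energy on \<open>G\<close>; the factor 2 counts the two
    mixed regions, which are mirror images of each other.\<close>
  have "gagliardo_energy s p UNIV (zero_ext G u) \<le> ennreal (1 + 2 * (K * C)) * gagliardo_energy s p G u"
    if u: "u \<in> compactly_supported G" for u
  proof -
    define f where "f = zero_ext G u"
    have [measurable]: "f \<in> borel_measurable borel"
      unfolding f_def by (intro borel_measurable_continuous_onI continuous_on_zero_ext G(1) u)
    define h where "h x y = hardy_kernel 1 s p G f x y * indicator G x" for x y
    have [measurable]: "(\<lambda>w. h (fst w) (snd w)) \<in> borel_measurable (borel \<Otimes>\<^sub>M borel)"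
      "(\<lambda>w. h (snd w) (fst w)) \<in> borel_measurable (borel \<Otimes>\<^sub>M borel)"
      "(\<lambda>y. h x y) \<in> borel_measurable borel" "(\<lambda>y. h y x) \<in> borel_measurable borel" for x
      unfolding h_def by measurable
    have off: "gagliardo_integrand s p f x y \<le> h x y" if "x \<in> G" "y \<notin> G" for x y
    proof -
      have "infdist x (frontier G) \<le> norm (x - y)"
        using infdist_frontier_le_dist[OF that] by (simp add: dist_norm)
      moreover have "infdist x (frontier G) > 0" using infdist_frontier_pos[OF G that(1)] .
      moreover have "f y = 0" using that by (simp add: f_def zero_ext_def)
      ultimately show ?thesis using that(1)
        by (simp add: gagliardo_integrand_def h_def hardy_kernel_def min_def)
    qed
    have zero: "gagliardo_integrand s p f x y = 0" if "x \<notin> G" "y \<notin> G" for x y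
      using that by (simp add: gagliardo_integrand_def f_def zero_ext_def)
    have pw: "gagliardo_integrand s p f x y \<le>
        gagliardo_integrand s p f x y * indicator G y * indicator G x + (h x y + h y x)" for x y
    proof (cases "x \<in> G"; cases "y \<in> G")
      assume "x \<in> G" "y \<notin> G"
      then show ?thesis using off[of x y] by (simp add: add_increasing2)
    next
      assume "x \<notin> G" "y \<in> G"
      then show ?thesis using off[of y x] gagliardo_integrand_commute[of s p f x y]
        by (simp add: add_increasing)
    qed (auto simp: zero)
    have "gagliardo_energy s p UNIV f = (\<integral>\<^sup>+x. \<integral>\<^sup>+y. gagliardo_integrand s p f x y \<partial>lborel \<partial>lborel)"
      by (simp add: gagliardo_energy_eq)
    also have "\<dots> \<le> (\<integral>\<^sup>+x. \<integral>\<^sup>+y. gagliardo_integrand s p f x y * indicator G y * indicator G x + (h x y + h y x) \<partial>lborel \<partial>lborel)"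
      by (intro nn_integral_mono pw)
    also have "\<dots> = gagliardo_energy s p G f + ((\<integral>\<^sup>+x. \<integral>\<^sup>+y. h x y \<partial>lborel \<partial>lborel) + (\<integral>\<^sup>+x. \<integral>\<^sup>+y. h y x \<partial>lborel \<partial>lborel))"
      unfolding gagliardo_energy_eq
      by (simp add: nn_integral_add nn_integral_multc)
    also have "(\<integral>\<^sup>+x. \<integral>\<^sup>+y. h y x \<partial>lborel \<partial>lborel) = (\<integral>\<^sup>+x. \<integral>\<^sup>+y. h x y \<partial>lborel \<partial>lborel)"
      by (rule lborel_pair.Fubini') (simp add: split_beta')
    also have "(\<integral>\<^sup>+x. \<integral>\<^sup>+y. h x y \<partial>lborel \<partial>lborel) = (\<integral>\<^sup>+x\<in>G. (\<integral>\<^sup>+y. hardy_kernel 1 s p G f x y \<partial>lborel) \<partial>lborel)"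
      unfolding h_def by (simp add: nn_integral_multc)
    also have "\<dots> \<le> ennreal K * hardy_integral s p G f" by (rule K(2)) simp
    also have "hardy_integral s p G f \<le> ennreal C * gagliardo_energy s p G f"
      using C(2)[OF u] unfolding f_def hardy_integral_zero_ext gagliardo_energy_zero_ext .
    finally have "gagliardo_energy s p UNIV f \<le> gagliardo_energy s p G f +
      (ennreal K * (ennreal C * gagliardo_energy s p G f) + ennreal K * (ennreal C * gagliardo_energy s p G f))"
      by (simp add: add_mono mult_left_mono)
    also have "\<dots> = (1 + 2 * ennreal (K * C)) * gagliardo_energy s p G f"
      using K(1) C(1) by (simp add: ennreal_mult distrib_right mult.assoc mult_2)
    also have "1 + 2 * ennreal (K * C) = ennreal (1 + 2 * (K * C))"
      using K(1) C(1) by (simp add: ennreal_plus ennreal_mult)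
    finally show ?thesis by (simp add: f_def gagliardo_energy_zero_ext)
  qed
  then show ?thesis unfolding admits_zero_extension_iff[OF p0]
    using K(1) C(1) by (intro exI[of _ "1 + 2 * (K * C)"]) (auto intro: add_pos_pos)
qed

section \<open>Whitney cubes and cutoffs\<close>

definition side :: "(real^'n) set \<Rightarrow> real" where
  "side Q = diameter Q / sqrt (real CARD('n))"

text \<open>It vanishes from distance \<open>side Q / 16\<close> on, because dilation by 9/8 moves
  each face outwards by exactly this amount. The bounded overlap of the dilated cubes thus passes to
  the supports of the cutoffs.\<close>

definition cutoff :: "(real^'n) set \<Rightarrow> real^'n \<Rightarrow> real" where
  "cutoff Q x = max 0 (1 - 16 * infdist x Q / side Q)"

lemma dyadic_cubeE:
  fixes Q :: "(real^'n) set"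
  assumes "dyadic_cube Q"
  obtains a b l where "Q = cbox a b" "l > 0" "\<And>i. b $ i = a $ i + l" "side Q = l"
proof -
  obtain k :: int and m :: "'n \<Rightarrow> int" where Q: "Q = cbox (\<chi> i. 2 powi k * of_int (m i)) (\<chi> i. 2 powi k * (of_int (m i) + 1))"
    using assms unfolding dyadic_cube_def by blast
  define a b :: "real^'n" where "a = (\<chi> i. 2 powi k * of_int (m i))" and "b = (\<chi> i. 2 powi k * (of_int (m i) + 1))"
  define l :: real where "l = 2 powi k"
  have l: "l > 0" by (simp add: l_def)
  have b: "b $ i = a $ i + l" for i by (simp add: a_def b_def l_def algebra_simps)
  have "diameter Q = dist a b"
    unfolding Q a_def[symmetric] b_def[symmetric] using b l
    by (intro diameter_cbox) (auto simp: Basis_vec_def inner_axis)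
  also have "dist a b = sqrt (real CARD('n)) * l"
    using l by (simp add: dist_norm norm_vec_def L2_set_def b real_sqrt_mult)
  finally have "side Q = l" by (simp add: side_def)
  with Q l b that show ?thesis unfolding a_def[symmetric] b_def[symmetric] by blast
qed

lemma diameter_eq_side: "diameter (Q :: (real^'n) set) = sqrt (real CARD('n)) * side Q"
  by (simp add: side_def)

lemma dyadic_cube_side_pos: "dyadic_cube Q \<Longrightarrow> 0 < side Q"
  by (erule dyadic_cubeE) simp

lemma dyadic_cube_compact: "dyadic_cube Q \<Longrightarrow> compact Q"
  by (erule dyadic_cubeE) (simp add: compact_cbox)

lemma dyadic_cube_nonempty:
  fixes Q :: "(real^'n) set"
  assumes "dyadic_cube Q" shows "Q \<noteq> {}"
proof -
  obtain a b :: "real^'n" and l where *: "Q = cbox a b" "l > 0" "\<And>i. b $ i = a $ i + l"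
    using assms by (rule dyadic_cubeE) blast
  then have "a \<in> Q" by (auto simp: mem_box_cart)
  then show ?thesis by auto
qed

lemma emeasure_dyadic_cube:
  fixes Q :: "(real^'n) set"
  assumes "dyadic_cube Q" shows "emeasure lborel Q = ennreal (side Q powr CARD('n))"
proof -
  obtain a b l where *: "Q = cbox a b" "l > 0" "\<And>i. b $ i = a $ i + l" "side Q = l"
    using assms by (rule dyadic_cubeE) blast
  have "emeasure lborel Q = ennreal (measure lborel (cbox a b))"
    unfolding *(1) using emeasure_lborel_cbox_finite[of a b]
    by (intro emeasure_eq_ennreal_measure) auto
  also have "measure lborel (cbox a b) = (\<Prod>i\<in>UNIV. b $ i - a $ i)"
    using * by (intro content_cbox_cart) (auto simp: interval_eq_empty_cart)
  also have "\<dots> = l powr CARD('n)" using * by (simp add: powr_realpow)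
  finally show ?thesis using *(4) by simp
qed

lemma dyadic_cube_contains_ball:
  fixes Q :: "(real^'n) set"
  assumes "dyadic_cube Q"
  obtains z where "ball z (side Q / 2) \<subseteq> Q"
proof -
  obtain a b l where *: "Q = cbox a b" "l > 0" "\<And>i. b $ i = a $ i + l" "side Q = l"
    using assms by (rule dyadic_cubeE) blast
  define z :: "real^'n" where "z = (\<chi> i. a $ i + l / 2)"
  have "ball z (l / 2) \<subseteq> Q"
  proof
    fix x assume "x \<in> ball z (l / 2)"
    then have x: "norm (z - x) < l / 2" by (simp add: dist_norm)
    have "\<bar>(z - x) $ i\<bar> < l / 2" for i using component_le_norm_cart[of "z - x" i] x by linarith
    then have "\<bar>a $ i + l / 2 - x $ i\<bar> < l / 2" for i by (simp add: z_def)
    then show "x \<in> Q" unfolding *(1) mem_box_cart *(3) by (smt (verit) field_sum_of_halves)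
  qed
  with *(4) that show ?thesis by simp
qed

text \<open>In each coordinate \<open>x\<close> lies within l/2 + l/16 = (9/8) * (l/2) of the
  centre, which is the reach of the dilated cube; \<open>w\<close> is the preimage of
  \<open>x\<close> under the dilation.\<close>

lemma infdist_less_imp_dilate:
  fixes Q :: "(real^'n) set"
  assumes Q: "dyadic_cube Q" and x: "infdist x Q < side Q / 16"
  shows "x \<in> dilate_cube (9/8) Q"
proof -
  obtain a b l where *: "Q = cbox a b" "l > 0" "\<And>i. b $ i = a $ i + l" "side Q = l"
    using Q by (rule dyadic_cubeE) blast
  have ne: "\<forall>i\<in>Basis. a \<bullet> i \<le> b \<bullet> i" using * by (auto simp: Basis_vec_def inner_axis)
  obtain q where q: "q \<in> Q" "infdist x Q = dist x q"
    using infdist_attains_inf[OF compact_imp_closed[OF dyadic_cube_compact[OF Q]] dyadic_cube_nonempty[OF Q]] by metis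
  define z where "z = midpoint (interval_lowerbound Q) (interval_upperbound Q)"
  have z: "z $ i = a $ i + l / 2" for i
    unfolding z_def *(1) using ne by (simp add: midpoint_def *(3) field_simps)
  define w where "w = z + (8/9) *\<^sub>R (x - z)"
  have "w \<in> Q" unfolding *(1) mem_box_cart
  proof (intro allI)
    fix i
    have "\<bar>(x - q) $ i\<bar> < l / 16" using component_le_norm_cart[of "x - q" i] x q * by (simp add: dist_norm)
    then have "\<bar>x $ i - q $ i\<bar> < l / 16" by simp
    moreover have "a $ i \<le> q $ i" "q $ i \<le> a $ i + l" using q(1) *(3) unfolding *(1) mem_box_cart by auto
    moreover have "w $ i = a $ i + l / 2 + (8/9) * (x $ i - (a $ i + l / 2))" by (simp add: w_def z)
    ultimately show "a $ i \<le> w $ i \<and> w $ i \<le> b $ i" unfolding *(3) by argo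
  qed
  moreover have "x = z + (9/8) *\<^sub>R (w - z)" by (simp add: w_def)
  ultimately show ?thesis unfolding dilate_cube_def Let_def z_def[symmetric] by blast
qed

lemma cutoff_bounds: "side Q > 0 \<Longrightarrow> 0 \<le> cutoff Q x" "side Q > 0 \<Longrightarrow> cutoff Q x \<le> 1"
  by (auto simp: cutoff_def infdist_nonneg)

lemma cutoff_eq_1: "x \<in> Q \<Longrightarrow> cutoff Q x = 1"
  by (simp add: cutoff_def)

lemma cutoff_nonzero:
  assumes "side Q > 0" "cutoff Q x \<noteq> 0"
  shows "infdist x Q < side Q / 16"
proof -
  have "16 * infdist x Q / side Q < 1" using assms(2) unfolding cutoff_def by linarith
  then show ?thesis using assms(1) by (simp add: divide_less_eq)
qed

lemma continuous_on_cutoff [continuous_intros]: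
  "side Q > 0 \<Longrightarrow> continuous_on S f \<Longrightarrow> continuous_on S (\<lambda>x. cutoff Q (f x))"
  unfolding cutoff_def by (intro continuous_intros) auto

lemma cutoff_lipschitz:
  assumes "side Q > 0"
  shows "\<bar>cutoff Q x - cutoff Q y\<bar> \<le> 16 / side Q * norm (x - y)"
proof -
  have "\<bar>cutoff Q x - cutoff Q y\<bar> \<le> \<bar>16 * infdist x Q / side Q - 16 * infdist y Q / side Q\<bar>"
    unfolding cutoff_def by linarith
  also have "\<dots> = 16 / side Q * \<bar>infdist x Q - infdist y Q\<bar>"
  proof -
    have "16 * infdist x Q / side Q - 16 * infdist y Q / side Q = 16 / side Q * (infdist x Q - infdist y Q)"
      by (simp add: diff_divide_distrib right_diff_distrib)
    then show ?thesis using assms by (simp only: abs_mult) simp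
  qed
  also have "\<dots> \<le> 16 / side Q * norm (x - y)"
    using infdist_triangle_abs[of x Q y] assms by (intro mult_left_mono) (simp_all add: dist_norm)
  finally show ?thesis .
qed

section \<open>Geometry of a Whitney decomposition\<close>

locale whitney =
  fixes c :: real and G :: "(real^'n) set" and W :: "(real^'n) set set"
  assumes G: "open G" "G \<noteq> {}" "G \<noteq> UNIV" and W: "whitney_decomposition c G W"
begin

abbreviation d where "d x \<equiv> infdist x (frontier G)"

lemma dyadic: "Q \<in> W \<Longrightarrow> dyadic_cube Q"
  using W by (simp add: whitney_decomposition_def)

lemma side_pos: "Q \<in> W \<Longrightarrow> 0 < side Q"
  using dyadic dyadic_cube_side_pos by blast

lemma Union_cubes: "\<Union>W = G"
  using W by (simp add: whitney_decomposition_def)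

lemma diameter_le_d:
  assumes "Q \<in> W" "x \<in> Q" shows "diameter Q \<le> d x"
proof -
  have "diameter Q \<le> setdist Q (frontier G)" using W assms(1) unfolding whitney_decomposition_def by blast
  also have "\<dots> \<le> setdist {x} (frontier G)"
    using assms frontier_nonempty_of_proper[OF G(2,3)] by (intro setdist_subset_left) auto
  finally show ?thesis by (simp add: infdist_eq_setdist)
qed

lemma d_le_diameter:
  assumes "Q \<in> W" "x \<in> Q" shows "d x \<le> 5 * diameter Q"
proof -
  have Q: "compact Q" "Q \<noteq> {}" using dyadic_cube_compact[OF dyadic] assms by auto
  obtain q z where qz: "q \<in> Q" "z \<in> frontier G" "dist q z = setdist Q (frontier G)"
    using setdist_compact_closed[OF Q(1) frontier_closed[of G] Q(2) frontier_nonempty_of_proper[OF G(2,3)]] by blast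
  have "d x \<le> dist x z" using qz by (intro infdist_le)
  also have "\<dots> \<le> dist x q + dist q z" by (rule dist_triangle)
  also have "dist x q \<le> diameter Q"
    using diameter_bounded_bound[OF compact_imp_bounded[OF Q(1)] assms(2) qz(1)] .
  also have "dist q z \<le> 4 * diameter Q" using qz(3) W assms(1) unfolding whitney_decomposition_def by metis
  finally show ?thesis by simp
qed

lemma d_pos: "x \<in> G \<Longrightarrow> 0 < d x"
  using infdist_frontier_pos G by blast

lemma sum_indicator_dilate_le:
  assumes "finite F" "F \<subseteq> W" "x \<in> G"
  shows "(\<Sum>Q\<in>F. indicator (dilate_cube (9/8) Q) x :: real) \<le> c" and one_le_c: "1 \<le> c"
proof -
  have *: "ennreal (\<Sum>Q\<in>F. indicator (dilate_cube (9/8) Q) x) \<le> ennreal c" if "finite F" "F \<subseteq> W" for F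
  proof -
    have "ennreal (\<Sum>Q\<in>F. indicator (dilate_cube (9/8) Q) x) = (\<Sum>Q\<in>F. indicator (dilate_cube (9/8) Q) x)"
      by (subst sum_ennreal[symmetric]) (auto simp: ennreal_indicator)
    also have "\<dots> \<le> (\<Sum>\<^sub>\<infinity>Q\<in>W. indicator (dilate_cube (9/8) Q) x)"
      using that by (subst nonneg_infsum_complete) (auto intro!: SUP_upper)
    also have "\<dots> \<le> ennreal c * indicator G x" using W unfolding whitney_decomposition_def by blast
    finally show ?thesis using assms(3) by simp
  qed
  \<comment> \<open>\<open>ennreal\<close> sends negative numbers to 0, so the overlap bound can be
    read in the reals only once \<open>c\<close> is known to be nonnegative. The cube through
    \<open>x\<close> alone gives \<open>c\<close> at least 1.\<close>
  obtain Q where Q: "Q \<in> W" "x \<in> Q" using Union_cubes assms(3) by auto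
  then have "x \<in> dilate_cube (9/8) Q"
    using side_pos[OF Q(1)] by (intro infdist_less_imp_dilate dyadic) auto
  with *[of "{Q}"] Q(1) have "ennreal 1 \<le> ennreal c" by simp
  then show c: "1 \<le> c" by (subst (asm) ennreal_le_iff2) auto
  show "(\<Sum>Q\<in>F. indicator (dilate_cube (9/8) Q) x :: real) \<le> c"
    using *[OF assms(1,2)] c by (subst (asm) ennreal_le_iff) auto
qed

lemma cutoff_nonzero_imp_dilate: "Q \<in> W \<Longrightarrow> cutoff Q x \<noteq> 0 \<Longrightarrow> x \<in> dilate_cube (9/8) Q"
  by (intro infdist_less_imp_dilate dyadic cutoff_nonzero side_pos)

lemma side_le_diameter: "Q \<in> W \<Longrightarrow> side Q \<le> diameter Q"
  using side_pos[of Q] by (simp add: diameter_eq_side)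

lemma cutoff_nonzero_imp_d_le:
  assumes Q: "Q \<in> W" and x: "cutoff Q x \<noteq> 0" shows "d x \<le> 6 * diameter Q"
proof -
  obtain q where q: "q \<in> Q" "infdist x Q = dist x q"
    using infdist_attains_inf[OF compact_imp_closed[OF dyadic_cube_compact[OF dyadic[OF Q]]]
        dyadic_cube_nonempty[OF dyadic[OF Q]]] by metis
  have "dist x q \<le> diameter Q"
    using cutoff_nonzero[OF side_pos[OF Q] x] q(2) side_le_diameter[OF Q] side_pos[OF Q] by simp
  then show ?thesis
    using infdist_triangle[of x "frontier G" q] d_le_diameter[OF Q q(1)] by simp
qed

text \<open>If |x - y| is at least d(x)/2, the trivial bound 1 is enough. Otherwise one of the
  points is close to \<open>Q\<close> and the other within d(x)/2 of it, so d(x) is at most 12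
  diameters, and the Lipschitz constant 16 / side is at most 192 sqrt(n) / d(x), where 192 = 16 *
  12. The indicators record that the difference vanishes unless one point lies in the dilated cube;
  they make the bound summable over \<open>Q\<close>.\<close>

lemma cutoff_diff_powr_le:
  assumes Q: "Q \<in> W" and x: "x \<in> G" and p: "0 < p"
  shows "\<bar>cutoff Q x - cutoff Q y\<bar> powr p \<le>
    min 1 (norm (x - y) / (d x / (192 * sqrt (real CARD('n))))) powr p *
    (indicator (dilate_cube (9/8) Q) x + indicator (dilate_cube (9/8) Q) y)"
proof (cases "cutoff Q x = 0 \<and> cutoff Q y = 0")
  case False
  let ?n = "sqrt (real CARD('n))"
  have l: "0 < side Q" using side_pos[OF Q] .
  have n: "1 \<le> ?n" by simp
  have dx: "0 < d x" using d_pos[OF x] .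
  have le1: "\<bar>cutoff Q x - cutoff Q y\<bar> \<le> 1"
    using cutoff_bounds[OF l, of x] cutoff_bounds[OF l, of y] by auto
  have "\<bar>cutoff Q x - cutoff Q y\<bar> \<le> norm (x - y) / (d x / (192 * ?n))"
  proof (cases "d x / 2 \<le> norm (x - y)")
    case True
    have "1 \<le> norm (x - y) * (192 * ?n) / d x"
      using True n dx mult_mono[of "d x / 2" "norm (x - y)" "192" "192 * ?n"] by (simp add: field_simps)
    then show ?thesis using le1 by simp
  next
    case near: False
    have "d x \<le> 12 * diameter Q"
    proof (cases "cutoff Q x = 0")
      case True
      then have "d y \<le> 6 * diameter Q" using False cutoff_nonzero_imp_d_le[OF Q, of y] by simp
      then show ?thesis using infdist_triangle[of x "frontier G" y] near by (simp add: dist_norm)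
    next
      case False
      then show ?thesis using cutoff_nonzero_imp_d_le[OF Q, of x] side_le_diameter[OF Q] l by linarith
    qed
    then have "16 / side Q \<le> 192 * ?n / d x"
      using l dx by (simp add: diameter_eq_side field_simps)
    then have "16 / side Q * norm (x - y) \<le> 192 * ?n / d x * norm (x - y)"
      by (intro mult_right_mono) auto
    with cutoff_lipschitz[OF l, of x y] show ?thesis by (simp add: field_simps)
  qed
  with le1 have "\<bar>cutoff Q x - cutoff Q y\<bar> powr p \<le> min 1 (norm (x - y) / (d x / (192 * ?n))) powr p * 1"
    using p by (simp add: powr_mono2)
  also have "\<dots> \<le> min 1 (norm (x - y) / (d x / (192 * ?n))) powr p *
    (indicator (dilate_cube (9/8) Q) x + indicator (dilate_cube (9/8) Q) y)"
    using False cutoff_nonzero_imp_dilate[OF Q] by (intro mult_left_mono) (auto simp: indicator_def)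
  finally show ?thesis .
qed (simp add: p)

text \<open>The product rule with \<open>f\<close> taken at \<open>x\<close> in the first term and
  the cutoff taken at \<open>y\<close> in the second, so that only |f(x)| meets the truncation at
  scale d(x). Bounded overlap sums the cubes; the 2 in \<open>2 * c\<close> counts the two
  indicators.\<close>

lemma sum_cutoff_diff_powr_le:
  assumes F: "finite F" "F \<subseteq> W" and x: "x \<in> G" and y: "y \<in> G" and p: "0 < p"
  shows "(\<Sum>Q\<in>F. \<bar>f x * cutoff Q x - f y * cutoff Q y\<bar> powr p)
    \<le> 2 powr p * c * \<bar>f x - f y\<bar> powr p + 2 powr p * (2 * c) * (\<bar>f x\<bar> powr p *
      min 1 (norm (x - y) / (d x / (192 * sqrt (real CARD('n))))) powr p)"
proof -
  let ?m = "min 1 (norm (x - y) / (d x / (192 * sqrt (real CARD('n))))) powr p"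
  let ?I = "\<lambda>Q x. indicator (dilate_cube (9/8) Q) x :: real"
  have "\<bar>f x * cutoff Q x - f y * cutoff Q y\<bar> powr p
      \<le> 2 powr p * (\<bar>f x\<bar> powr p * ?m * (?I Q x + ?I Q y) + \<bar>f x - f y\<bar> powr p * ?I Q y)" if "Q \<in> F" for Q
  proof -
    have Q: "Q \<in> W" using that F by auto
    have l: "0 < side Q" using side_pos[OF Q] .
    have "f x * cutoff Q x - f y * cutoff Q y = f x * (cutoff Q x - cutoff Q y) + (f x - f y) * cutoff Q y"
      by (simp add: algebra_simps)
    then have "\<bar>f x * cutoff Q x - f y * cutoff Q y\<bar> \<le> \<bar>f x\<bar> * \<bar>cutoff Q x - cutoff Q y\<bar> + \<bar>f x - f y\<bar> * \<bar>cutoff Q y\<bar>"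
      by (metis abs_mult abs_triangle_ineq)
    then have "\<bar>f x * cutoff Q x - f y * cutoff Q y\<bar> powr p \<le>
        (\<bar>f x\<bar> * \<bar>cutoff Q x - cutoff Q y\<bar> + \<bar>f x - f y\<bar> * \<bar>cutoff Q y\<bar>) powr p"
      using p by (intro powr_mono2) auto
    also have "\<dots> \<le> 2 powr p * ((\<bar>f x\<bar> * \<bar>cutoff Q x - cutoff Q y\<bar>) powr p + (\<bar>f x - f y\<bar> * \<bar>cutoff Q y\<bar>) powr p)"
      using p by (intro powr_add_le) auto
    also have "(\<bar>f x\<bar> * \<bar>cutoff Q x - cutoff Q y\<bar>) powr p \<le> \<bar>f x\<bar> powr p * ?m * (?I Q x + ?I Q y)"
      using mult_left_mono[OF cutoff_diff_powr_le[OF Q x p, of y], of "\<bar>f x\<bar> powr p"]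
      by (simp add: powr_mult mult.assoc)
    also have "(\<bar>f x - f y\<bar> * \<bar>cutoff Q y\<bar>) powr p \<le> \<bar>f x - f y\<bar> powr p * ?I Q y"
    proof (cases "cutoff Q y = 0")
      case False
      have "\<bar>cutoff Q y\<bar> powr p \<le> 1 powr p"
        using cutoff_bounds[OF l, of y] p by (intro powr_mono2) auto
      then show ?thesis using cutoff_nonzero_imp_dilate[OF Q False] by (simp add: powr_mult mult_left_le)
    qed simp
    finally show ?thesis by simp
  qed
  then have "(\<Sum>Q\<in>F. \<bar>f x * cutoff Q x - f y * cutoff Q y\<bar> powr p)
    \<le> (\<Sum>Q\<in>F. 2 powr p * (\<bar>f x\<bar> powr p * ?m * (?I Q x + ?I Q y) + \<bar>f x - f y\<bar> powr p * ?I Q y))"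
    by (rule sum_mono)
  also have "\<dots> = 2 powr p * (\<bar>f x\<bar> powr p * ?m * ((\<Sum>Q\<in>F. ?I Q x) + (\<Sum>Q\<in>F. ?I Q y)) + \<bar>f x - f y\<bar> powr p * (\<Sum>Q\<in>F. ?I Q y))"
    by (simp add: sum_distrib_left[symmetric] sum.distrib)
  also have "\<dots> \<le> 2 powr p * (\<bar>f x\<bar> powr p * ?m * (c + c) + \<bar>f x - f y\<bar> powr p * c)"
    using sum_indicator_dilate_le[OF F x] sum_indicator_dilate_le[OF F y]
    by (intro mult_left_mono add_mono) auto
  also have "\<dots> = 2 powr p * c * \<bar>f x - f y\<bar> powr p + 2 powr p * (2 * c) * (\<bar>f x\<bar> powr p * ?m)"
    by (simp add: algebra_simps)
  finally show ?thesis .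
qed

text \<open>The energies of the products with the cutoffs are added under the integral sign, where
  bounded overlap applies. The resulting constant does not depend on the finite family of cubes, so
  the bound passes to the sum over all of \<open>W\<close>.\<close>

lemma hardy_imp_quasiadditive:
  assumes sp: "0 < s" "s < 1" "1 < p" and H: "hardy_inequality s p G"
  shows "quasiadditive s p G W"
proof -
  have p0: "0 < p" using sp by simp
  define L where "L = 192 * sqrt (real CARD('n))"
  have L: "L > 0" by (simp add: L_def)
  obtain C where C: "C > 0" "\<And>u. u \<in> compactly_supported G \<Longrightarrow>
      hardy_integral s p G u \<le> ennreal C * gagliardo_energy s p G u"
    using H unfolding hardy_inequality_iff[OF p0] by auto
  obtain K where K: "K > 0" "\<And>u. u \<in> borel_measurable borel \<Longrightarrow>
      (\<integral>\<^sup>+x\<in>G. (\<integral>\<^sup>+y. hardy_kernel L s p G u x y \<partial>lborel) \<partial>lborel) \<le> ennreal K * hardy_integral s p G u"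
    using nn_integral_hardy_kernel_le[OF sp L, where 'n='n] G by auto
  have [measurable]: "G \<in> sets borel" using G(1) by simp
  have c: "1 \<le> c" using one_le_c[of "{}"] G(2) by auto
  define N1 N2 where "N1 = 2 powr p * c" and "N2 = 2 powr p * (2 * c)"
  have N: "N1 > 0" "N2 > 0" using c by (auto simp: N1_def N2_def)
  \<comment> \<open>\<open>N1\<close> multiplies the energy itself. The term with \<open>N2\<close>
    goes through the kernel estimate, at cost \<open>K\<close>, and then through Hardy's inequality,
    at cost \<open>C\<close>.\<close>
  define N where "N = N1 + N2 * (K * C)"
  have N0: "N > 0" unfolding N_def using N K(1) C(1) by (simp add: add_pos_pos)
  have fin: "(\<Sum>Q\<in>F. capacity s p (T \<inter> Q) G) \<le> ennreal N * gagliardo_energy s p G u"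
    if F: "finite F" "F \<subseteq> W" and u: "u \<in> compactly_supported G" "\<And>x. x \<in> T \<Longrightarrow> u x \<ge> 1" for F T u
  proof -
    define f where "f = zero_ext G u"
    have [measurable]: "f \<in> borel_measurable borel"
      unfolding f_def by (intro borel_measurable_continuous_onI continuous_on_zero_ext G(1) u)
    have cutm: "cutoff Q \<in> borel_measurable borel" if "Q \<in> F" for Q
    proof -
      have "side Q > 0" using that F side_pos by auto
      then show ?thesis by (intro borel_measurable_continuous_onI continuous_intros)
    qed
    have fcm: "(\<lambda>x. f x * cutoff Q x) \<in> borel_measurable borel" if "Q \<in> F" for Q
      using cutm[OF that] by measurable
    have gm [measurable]: "(\<lambda>w. gagliardo_integrand s p (\<lambda>x. f x * cutoff Q x) (fst w) (snd w)) \<in> borel_measurable (borel \<Otimes>\<^sub>M borel)"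
      "(\<lambda>y. gagliardo_integrand s p (\<lambda>x. f x * cutoff Q x) x y) \<in> borel_measurable borel" if "Q \<in> F" for Q x
      using fcm[OF that] by measurable
    have im: "(\<lambda>x. \<integral>\<^sup>+y\<in>G. gagliardo_integrand s p (\<lambda>x. f x * cutoff Q x) x y \<partial>lborel) \<in> borel_measurable borel" if "Q \<in> F" for Q
      using gm[OF that] by measurable
    have "(\<Sum>Q\<in>F. capacity s p (T \<inter> Q) G) \<le> (\<Sum>Q\<in>F. gagliardo_energy s p G (\<lambda>x. f x * cutoff Q x))"
    proof (rule sum_mono)
      fix Q assume "Q \<in> F"
      then have l: "side Q > 0" using F side_pos by auto
      have "capacity s p (T \<inter> Q) G \<le> gagliardo_energy s p G (\<lambda>x. u x * cutoff Q x)"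
      proof (rule capacity_le[OF p0])
        show "(\<lambda>x. u x * cutoff Q x) \<in> compactly_supported G"
          using u(1) l by (intro compactly_supported_subset[OF u(1)])
            (auto simp: compactly_supported_def intro!: continuous_intros)
      qed (use u(2) cutoff_eq_1[of _ Q] in force)
      also have "\<dots> = gagliardo_energy s p G (\<lambda>x. f x * cutoff Q x)"
        by (rule gagliardo_energy_cong) (simp add: f_def zero_ext_def)
      finally show "capacity s p (T \<inter> Q) G \<le> gagliardo_energy s p G (\<lambda>x. f x * cutoff Q x)" .
    qed
    also have "\<dots> = (\<integral>\<^sup>+x. (\<Sum>Q\<in>F. (\<integral>\<^sup>+y. gagliardo_integrand s p (\<lambda>x. f x * cutoff Q x) x y * indicator G y \<partial>lborel) * indicator G x) \<partial>lborel)"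
      unfolding gagliardo_energy_eq by (rule nn_integral_sum[symmetric]) (use im in auto)
    also have "\<dots> = (\<integral>\<^sup>+x\<in>G. (\<integral>\<^sup>+y\<in>G. (\<Sum>Q\<in>F. gagliardo_integrand s p (\<lambda>x. f x * cutoff Q x) x y) \<partial>lborel) \<partial>lborel)"
      by (intro nn_integral_cong, subst sum_distrib_right[symmetric], subst nn_integral_sum[symmetric])
        (use gm(2) in \<open>auto simp: sum_distrib_right\<close>)
    also have "\<dots> \<le> (\<integral>\<^sup>+x\<in>G. (\<integral>\<^sup>+y\<in>G. (ennreal N1 * gagliardo_integrand s p f x y + ennreal N2 * hardy_kernel L s p G f x y) \<partial>lborel) \<partial>lborel)"
    proof -
      have "(\<Sum>Q\<in>F. gagliardo_integrand s p (\<lambda>x. f x * cutoff Q x) x y)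
          \<le> ennreal N1 * gagliardo_integrand s p f x y + ennreal N2 * hardy_kernel L s p G f x y"
        if xy: "x \<in> G" "y \<in> G" for x y
      proof -
        let ?r = "norm (x - y) powr (real CARD('n) + s * p)"
        have "(\<Sum>Q\<in>F. gagliardo_integrand s p (\<lambda>x. f x * cutoff Q x) x y)
          = ennreal ((\<Sum>Q\<in>F. \<bar>f x * cutoff Q x - f y * cutoff Q y\<bar> powr p) / ?r)"
          unfolding gagliardo_integrand_def by (simp add: sum_divide_distrib sum_ennreal)
        also have "\<dots> \<le> ennreal ((N1 * \<bar>f x - f y\<bar> powr p + N2 * (\<bar>f x\<bar> powr p * min 1 (norm (x - y) / (d x / L)) powr p)) / ?r)"
          using sum_cutoff_diff_powr_le[OF F xy p0, of f] unfolding N1_def N2_def L_def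
          by (intro ennreal_leI divide_right_mono) auto
        also have "\<dots> = ennreal N1 * gagliardo_integrand s p f x y + ennreal N2 * hardy_kernel L s p G f x y"
          using N unfolding gagliardo_integrand_def hardy_kernel_def
          by (simp add: ennreal_mult[symmetric] ennreal_plus[symmetric] add_divide_distrib del: ennreal_plus)
        finally show ?thesis .
      qed
      then show ?thesis
        by (intro nn_integral_mono) (auto simp: indicator_def intro!: nn_integral_mono)
    qed
    also have "\<dots> \<le> (\<integral>\<^sup>+x. (ennreal N1 * (\<integral>\<^sup>+y\<in>G. gagliardo_integrand s p f x y \<partial>lborel) * indicator G x
        + ennreal N2 * ((\<integral>\<^sup>+y. hardy_kernel L s p G f x y \<partial>lborel) * indicator G x)) \<partial>lborel)"
    proof (rule nn_integral_mono)
      fix x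
      have "(\<integral>\<^sup>+y\<in>G. (ennreal N1 * gagliardo_integrand s p f x y + ennreal N2 * hardy_kernel L s p G f x y) \<partial>lborel)
        = ennreal N1 * (\<integral>\<^sup>+y\<in>G. gagliardo_integrand s p f x y \<partial>lborel) + ennreal N2 * (\<integral>\<^sup>+y\<in>G. hardy_kernel L s p G f x y \<partial>lborel)"
        by (simp add: distrib_right mult.assoc nn_integral_add nn_integral_cmult)
      also have "(\<integral>\<^sup>+y\<in>G. hardy_kernel L s p G f x y \<partial>lborel) \<le> (\<integral>\<^sup>+y. hardy_kernel L s p G f x y \<partial>lborel)"
        by (intro nn_integral_mono) (auto simp: indicator_def)
      finally show "(\<integral>\<^sup>+y\<in>G. (ennreal N1 * gagliardo_integrand s p f x y + ennreal N2 * hardy_kernel L s p G f x y) \<partial>lborel) * indicator G x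
        \<le> ennreal N1 * (\<integral>\<^sup>+y\<in>G. gagliardo_integrand s p f x y \<partial>lborel) * indicator G x
        + ennreal N2 * ((\<integral>\<^sup>+y. hardy_kernel L s p G f x y \<partial>lborel) * indicator G x)"
        by (auto simp: indicator_def add_left_mono mult_left_mono)
    qed
    also have "\<dots> = ennreal N1 * gagliardo_energy s p G f + ennreal N2 * (\<integral>\<^sup>+x\<in>G. (\<integral>\<^sup>+y. hardy_kernel L s p G f x y \<partial>lborel) \<partial>lborel)"
      unfolding gagliardo_energy_eq by (simp add: nn_integral_add nn_integral_cmult mult.assoc)
    also have "(\<integral>\<^sup>+x\<in>G. (\<integral>\<^sup>+y. hardy_kernel L s p G f x y \<partial>lborel) \<partial>lborel) \<le> ennreal K * hardy_integral s p G f"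
      by (rule K(2)) simp
    also have "hardy_integral s p G f \<le> ennreal C * gagliardo_energy s p G f"
      using C(2)[OF u(1)] unfolding f_def hardy_integral_zero_ext gagliardo_energy_zero_ext .
    finally have "(\<Sum>Q\<in>F. capacity s p (T \<inter> Q) G) \<le> ennreal N1 * gagliardo_energy s p G f
        + ennreal N2 * (ennreal K * (ennreal C * gagliardo_energy s p G f))"
      by (simp add: add_left_mono mult_left_mono)
    also have "\<dots> = ennreal N * gagliardo_energy s p G f"
      unfolding N_def using N K(1) C(1)
      by (simp add: ennreal_mult distrib_right mult.assoc)
    finally show ?thesis by (simp add: f_def gagliardo_energy_zero_ext)
  qed
  have "(\<Sum>\<^sub>\<infinity>Q\<in>W. capacity s p (T \<inter> Q) G) \<le> ennreal N * capacity s p T G" for T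
    using fin by (intro le_capacityI[OF p0 N0], subst nonneg_infsum_complete) (auto intro!: SUP_least)
  then show ?thesis unfolding quasiadditive_def using N0 by blast
qed

lemma quasiadditive_imp_weakly:
  assumes "quasiadditive s p G W"
  shows "weakly_quasiadditive s p G W"
proof -
  have *: "compact (\<Union>E) \<and> \<Union>E \<subseteq> G" if "E \<subseteq> W \<and> finite E" for E
    using that Union_cubes dyadic_cube_compact[OF dyadic] by (auto intro!: compact_Union)
  obtain N where "N > 0" "\<And>K. compact K \<and> K \<subseteq> G \<Longrightarrow>
      (\<Sum>\<^sub>\<infinity>Q\<in>W. capacity s p (K \<inter> Q) G) \<le> ennreal N * capacity s p K G"
    using assms unfolding quasiadditive_def by auto
  with * show ?thesis unfolding weakly_quasiadditive_def by (intro exI[of _ N]) auto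
qed

end

section \<open>Capacity of a cube\<close>

lemma (in prob_space) abs_diff_expectation_powr_le:
  fixes X :: "'a \<Rightarrow> real"
  assumes "1 < p" "integrable M X"
  shows "ennreal (\<bar>a - expectation X\<bar> powr p) \<le> (\<integral>\<^sup>+\<omega>. ennreal (\<bar>a - X \<omega>\<bar> powr p) \<partial>M)"
proof -
  have "expectation (\<lambda>\<omega>. a - X \<omega>) = a - expectation X" using assms(2) by (simp add: prob_space)
  then show ?thesis
    using abs_expectation_powr_le[OF assms(1), of "\<lambda>\<omega>. a - X \<omega>"] assms(2) by (simp del: Bochner_Integration.integral_diff)
qed

text \<open>Jensen's inequality twice: in \<open>M\<close> with the other mean as a constant, then
  in \<open>N\<close> for each fixed point.\<close>

lemma diff_expectations_powr_le:
  fixes f :: "'a \<Rightarrow> real"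
  assumes M: "prob_space M" "prob_space N" and p: "1 < p" and f: "integrable M f" "integrable N f"
  shows "ennreal (\<bar>(\<integral>x. f x \<partial>M) - (\<integral>y. f y \<partial>N)\<bar> powr p)
    \<le> (\<integral>\<^sup>+x. \<integral>\<^sup>+y. ennreal (\<bar>f x - f y\<bar> powr p) \<partial>N \<partial>M)"
proof -
  have "ennreal (\<bar>(\<integral>y. f y \<partial>N) - (\<integral>x. f x \<partial>M)\<bar> powr p) \<le> (\<integral>\<^sup>+x. ennreal (\<bar>(\<integral>y. f y \<partial>N) - f x\<bar> powr p) \<partial>M)"
    by (rule prob_space.abs_diff_expectation_powr_le[OF M(1) p f(1)])
  also have "\<dots> \<le> (\<integral>\<^sup>+x. \<integral>\<^sup>+y. ennreal (\<bar>f x - f y\<bar> powr p) \<partial>N \<partial>M)"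
    using prob_space.abs_diff_expectation_powr_le[OF M(2) p f(2)]
    by (intro nn_integral_mono) (simp add: abs_minus_commute)
  finally show ?thesis by (simp add: abs_minus_commute)
qed

lemma emeasure_ball_powr:
  fixes z :: "'a::euclidean_space"
  assumes "0 < r"
  shows "emeasure lborel (ball z r) = ennreal (unit_ball_vol DIM('a) * r powr DIM('a))"
  using assms by (simp add: emeasure_ball powr_realpow)

lemma prob_space_uniform_ball:
  fixes z :: "'a::euclidean_space"
  assumes "0 < r" shows "prob_space (uniform_measure lborel (ball z r))"
  using assms unit_ball_vol_pos[of "DIM('a)"]
  by (intro prob_space_uniform_measure) (auto simp: emeasure_ball_powr simp del: unit_ball_vol_pos)

text \<open>The averages over the balls of radius 2^j * r start at a value of at least 1 and tend to
  0, so their increments sum to at least 1. Each increment is bounded by the energy through Jensen's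
  inequality, and the geometric sum of these bounds is governed by the first, which scales like
  r^(sp - n) to the power 1/p.\<close>

lemma gagliardo_energy_ge_of_ball:
  fixes s p :: real
  assumes sp: "0 < s" "1 < p" "s * p < real CARD('n)"
  shows "\<exists>C>0. \<forall>f (z :: real^'n) r M R. f \<in> borel_measurable borel \<and> (\<forall>x. \<bar>f x\<bar> \<le> M) \<and> (\<forall>x. x \<notin> ball 0 R \<longrightarrow> f x = 0)
    \<and> 0 < r \<and> (\<forall>x\<in>ball z r. 1 \<le> f x) \<longrightarrow>
      ennreal (r powr (real CARD('n) - s * p)) \<le> ennreal C * gagliardo_energy s p UNIV f"
proof -
  define n where "n = real CARD('n)"
  define \<omega> where "\<omega> = unit_ball_vol n"
  have \<omega>: "\<omega> > 0" unfolding \<omega>_def n_def by simp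
  have n0: "n > 0" unfolding n_def by simp
  \<comment> \<open>Points of two consecutive balls are less than 4 times the smaller radius apart,
    and averaging over both divides by two volumes: this gives 4^(n + sp) and the square of
    \<open>\<omega>\<close>. The ratio \<open>q\<close> below is less than 1 because sp < n.\<close>
  define D where "D = 4 powr (n + s * p) / \<omega>\<^sup>2"
  have D: "D > 0" unfolding D_def using \<omega> by simp
  define q where "q = 2 powr ((s * p - n) / p)"
  have q: "0 < q" "q < 1" unfolding q_def using sp by (auto simp: n_def powr_less_one divide_less_0_iff)
  define C where "C = D / (1 - q) powr p"
  have C: "C > 0" unfolding C_def using D q by simp
  have ball: "emeasure lborel (ball z r) = ennreal (\<omega> * r powr n)" if "r > 0" for r and z :: "real^'n"
    using that by (simp add: emeasure_ball_powr \<omega>_def n_def)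
  have [measurable]: "ball z r \<in> sets borel" for r and z :: "real^'n" by simp
  have main: "ennreal (r powr (n - s * p)) \<le> ennreal C * gagliardo_energy s p UNIV f"
    if [measurable]: "f \<in> borel_measurable borel" and M: "\<And>x. \<bar>f x\<bar> \<le> M" and R: "\<And>x. x \<notin> ball 0 R \<Longrightarrow> f x = 0"
      and r: "0 < r" and f1: "\<And>x. x \<in> ball z r \<Longrightarrow> 1 \<le> f x" for f and z :: "real^'n" and r M R
  proof (cases "gagliardo_energy s p UNIV f")
    case top
    then show ?thesis using C by (simp add: ennreal_mult_top)
  next
    case (real e)
    define \<rho> where "\<rho> j = 2 ^ j * r" for j :: nat
    have \<rho>: "\<rho> j > 0" for j using r by (simp add: \<rho>_def)
    define m where "m j = uniform_measure lborel (ball z (\<rho> j))" for j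
    have m: "prob_space (m j)" for j unfolding m_def by (rule prob_space_uniform_ball[OF \<rho>])
    have sets[measurable_cong]: "sets (m j) = sets borel" for j unfolding m_def by simp
    have int: "integrable (m j) f" for j
    proof -
      interpret prob_space "m j" by (rule m)
      show ?thesis using M by (intro integrable_const_bound[of _ M]) auto
    qed
    define A where "A j = (\<integral>x. f x \<partial>m j)" for j
    have nnm: "(\<integral>\<^sup>+x. g x \<partial>m j) = (\<integral>\<^sup>+x\<in>ball z (\<rho> j). g x \<partial>lborel) / ennreal (\<omega> * \<rho> j powr n)"
      if "g \<in> borel_measurable borel" for g j
      unfolding m_def using that by (subst nn_integral_uniform_measure) (auto simp: ball[OF \<rho>])
    define H where "H = (D * e * r powr (s * p - n)) powr (1 / p)"
    have step: "\<bar>A j - A (Suc j)\<bar> \<le> H * q ^ j" for j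
    proof -
      let ?B = "ball z (\<rho> j)" and ?B' = "ball z (\<rho> (Suc j))"
      let ?R = "(4 * \<rho> j) powr (n + s * p)"
      have "ennreal (\<bar>A j - A (Suc j)\<bar> powr p) \<le> (\<integral>\<^sup>+x. \<integral>\<^sup>+y. ennreal (\<bar>f x - f y\<bar> powr p) \<partial>m (Suc j) \<partial>m j)"
        unfolding A_def by (rule diff_expectations_powr_le[OF m m sp(2) int int])
      also have "\<dots> = (\<integral>\<^sup>+x\<in>?B. (\<integral>\<^sup>+y\<in>?B'. ennreal (\<bar>f x - f y\<bar> powr p) \<partial>lborel) / ennreal (\<omega> * \<rho> (Suc j) powr n) \<partial>lborel) / ennreal (\<omega> * \<rho> j powr n)"
      proof -
        have "(\<integral>\<^sup>+x. \<integral>\<^sup>+y. ennreal (\<bar>f x - f y\<bar> powr p) \<partial>m (Suc j) \<partial>m j)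
          = (\<integral>\<^sup>+x. (\<integral>\<^sup>+y\<in>?B'. ennreal (\<bar>f x - f y\<bar> powr p) \<partial>lborel) / ennreal (\<omega> * \<rho> (Suc j) powr n) \<partial>m j)"
          by (simp add: nnm)
        also have "\<dots> = (\<integral>\<^sup>+x\<in>?B. (\<integral>\<^sup>+y\<in>?B'. ennreal (\<bar>f x - f y\<bar> powr p) \<partial>lborel) / ennreal (\<omega> * \<rho> (Suc j) powr n) \<partial>lborel) / ennreal (\<omega> * \<rho> j powr n)"
          by (rule nnm) measurable
        finally show ?thesis .
      qed
      also have "(\<integral>\<^sup>+x\<in>?B. (\<integral>\<^sup>+y\<in>?B'. ennreal (\<bar>f x - f y\<bar> powr p) \<partial>lborel) / ennreal (\<omega> * \<rho> (Suc j) powr n) \<partial>lborel)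
        \<le> (\<integral>\<^sup>+x. ennreal (?R / (\<omega> * \<rho> (Suc j) powr n)) * (\<integral>\<^sup>+y. gagliardo_integrand s p f x y \<partial>lborel) \<partial>lborel)"
      proof (rule nn_integral_mono)
        fix x
        show "(\<integral>\<^sup>+y\<in>?B'. ennreal (\<bar>f x - f y\<bar> powr p) \<partial>lborel) / ennreal (\<omega> * \<rho> (Suc j) powr n) * indicator ?B x
          \<le> ennreal (?R / (\<omega> * \<rho> (Suc j) powr n)) * (\<integral>\<^sup>+y. gagliardo_integrand s p f x y \<partial>lborel)"
        proof (cases "x \<in> ?B")
          case True
          have "(\<integral>\<^sup>+y\<in>?B'. ennreal (\<bar>f x - f y\<bar> powr p) \<partial>lborel) \<le> (\<integral>\<^sup>+y. ennreal ?R * gagliardo_integrand s p f x y \<partial>lborel)"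
          proof (rule nn_integral_mono)
            fix y
            show "ennreal (\<bar>f x - f y\<bar> powr p) * indicator ?B' y \<le> ennreal ?R * gagliardo_integrand s p f x y"
            proof (cases "y \<in> ?B' \<and> x \<noteq> y")
              case xy: True
              have "norm (x - y) \<le> dist z x + dist z y" using dist_triangle3[of x y z] by (simp add: dist_norm)
              also have "\<dots> \<le> 4 * \<rho> j"
              proof -
                have "\<rho> (Suc j) = 2 * \<rho> j" by (simp add: \<rho>_def)
                then show ?thesis using True xy \<rho>[of j] by auto
              qed
              finally have "norm (x - y) powr (n + s * p) \<le> ?R" using sp n0 by (intro powr_mono2) auto
              then have "\<bar>f x - f y\<bar> powr p * norm (x - y) powr (n + s * p) \<le> ?R * \<bar>f x - f y\<bar> powr p"
                by (subst mult.commute) (intro mult_right_mono, auto)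
              then have "\<bar>f x - f y\<bar> powr p \<le> ?R * (\<bar>f x - f y\<bar> powr p / norm (x - y) powr (n + s * p))"
                using xy by (simp add: field_simps)
              then show ?thesis using xy unfolding gagliardo_integrand_def n_def[symmetric]
                by (simp add: ennreal_mult[symmetric] ennreal_leI)
            next
              case False
              then show ?thesis using sp by (auto simp: indicator_def)
            qed
          qed
          also have "\<dots> = ennreal ?R * (\<integral>\<^sup>+y. gagliardo_integrand s p f x y \<partial>lborel)"
            by (rule nn_integral_cmult) simp
          finally have "(\<integral>\<^sup>+y\<in>?B'. ennreal (\<bar>f x - f y\<bar> powr p) \<partial>lborel) / ennreal (\<omega> * \<rho> (Suc j) powr n)
             \<le> ennreal ?R * (\<integral>\<^sup>+y. gagliardo_integrand s p f x y \<partial>lborel) / ennreal (\<omega> * \<rho> (Suc j) powr n)"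
            by (rule divide_right_mono_ennreal)
          also have "\<dots> = ennreal (?R / (\<omega> * \<rho> (Suc j) powr n)) * (\<integral>\<^sup>+y. gagliardo_integrand s p f x y \<partial>lborel)"
            using \<omega> \<rho>[of "Suc j"] by (simp add: divide_ennreal[symmetric] ennreal_times_divide mult.commute)
          finally show ?thesis using True by simp
        qed simp
      qed
      also have "\<dots> = ennreal (?R / (\<omega> * \<rho> (Suc j) powr n)) * ennreal e"
        using real by (subst nn_integral_cmult) (auto simp: gagliardo_energy_eq)
      finally have "ennreal (\<bar>A j - A (Suc j)\<bar> powr p) \<le> ennreal (?R / (\<omega> * \<rho> (Suc j) powr n)) * ennreal e / ennreal (\<omega> * \<rho> j powr n)"
        by (simp add: divide_right_mono_ennreal)
      also have "\<dots> = ennreal (?R / (\<omega> * \<rho> (Suc j) powr n) * e / (\<omega> * \<rho> j powr n))"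
        using \<omega> \<rho>[of j] \<rho>[of "Suc j"] real by (simp add: divide_ennreal ennreal_mult[symmetric])
      finally have "\<bar>A j - A (Suc j)\<bar> powr p \<le> ?R / (\<omega> * \<rho> (Suc j) powr n) * e / (\<omega> * \<rho> j powr n)"
        using \<omega> \<rho>[of j] \<rho>[of "Suc j"] real by (subst (asm) ennreal_le_iff) auto
      also have "\<dots> \<le> ?R / (\<omega> * \<rho> j powr n) * e / (\<omega> * \<rho> j powr n)"
        using \<omega> \<rho>[of j] real n0 r
        by (intro divide_right_mono mult_right_mono divide_left_mono mult_left_mono powr_mono2 mult_pos_pos) (auto simp: \<rho>_def)
      also have "\<dots> = D * e * (\<rho> j) powr (s * p - n)"
        using \<rho>[of j] \<omega> by (simp add: D_def powr_mult powr_add powr_diff field_simps power2_eq_square)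
      also have "(\<rho> j) powr (s * p - n) = r powr (s * p - n) * (q ^ j) powr p"
        using r sp by (simp add: \<rho>_def q_def powr_mult powr_powr powr_realpow[symmetric] mult.commute)
      finally have "\<bar>A j - A (Suc j)\<bar> powr p \<le> (D * e * r powr (s * p - n)) * (q ^ j) powr p" by (simp add: mult.assoc)
      then have "(\<bar>A j - A (Suc j)\<bar> powr p) powr (1 / p) \<le> ((D * e * r powr (s * p - n)) * (q ^ j) powr p) powr (1 / p)"
        using sp by (intro powr_mono2) auto
      then show ?thesis using sp D q real r unfolding H_def by (simp add: powr_powr powr_mult)
    qed
    \<comment> \<open>\<open>R\<close> may be negative, while the volume formula wants a positive
      radius.\<close>
    define R' where "R' = \<bar>R\<bar> + 1"
    have R': "R' > 0" by (simp add: R'_def)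
    \<comment> \<open>The integral of |f| stays below \<open>M\<close> times a fixed volume while
      the averaging balls grow, so the averages tend to 0. \<open>M\<close> and \<open>R'\<close>
      affect the rate of this limit but not \<open>C\<close>.\<close>
    have Abd: "\<bar>A J\<bar> \<le> M * R' powr n / r powr n * (2 powr - n) ^ J" for J
    proof -
      have M0: "0 \<le> M" using M[of 0] by linarith
      have "ennreal \<bar>A J\<bar> \<le> (\<integral>\<^sup>+x. ennreal \<bar>f x\<bar> \<partial>m J)"
        unfolding A_def using integral_norm_bound_ennreal[OF int[of J]] by simp
      also have "\<dots> = (\<integral>\<^sup>+x\<in>ball z (\<rho> J). ennreal \<bar>f x\<bar> \<partial>lborel) / ennreal (\<omega> * \<rho> J powr n)"
        by (rule nnm) measurable
      also have "(\<integral>\<^sup>+x\<in>ball z (\<rho> J). ennreal \<bar>f x\<bar> \<partial>lborel) \<le> (\<integral>\<^sup>+x. ennreal M * indicator (ball (0::real^'n) R') x \<partial>lborel)"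
      proof (rule nn_integral_mono)
        fix x
        have "x \<in> ball 0 R'" if "f x \<noteq> 0" using R[of x] that by (force simp: R'_def)
        then show "ennreal \<bar>f x\<bar> * indicator (ball z (\<rho> J)) x \<le> ennreal M * indicator (ball 0 R') x"
          using M[of x] by (cases "f x = 0") (auto simp: indicator_def ennreal_leI)
      qed
      also have "\<dots> = ennreal M * ennreal (\<omega> * R' powr n)"
        by (subst nn_integral_cmult_indicator) (auto simp: ball[OF R'])
      finally have "ennreal \<bar>A J\<bar> \<le> ennreal M * ennreal (\<omega> * R' powr n) / ennreal (\<omega> * \<rho> J powr n)"
        by (simp add: divide_right_mono_ennreal)
      also have "\<dots> = ennreal (M * (\<omega> * R' powr n) / (\<omega> * \<rho> J powr n))"
        using \<omega> \<rho>[of J] M0 by (simp add: divide_ennreal ennreal_mult[symmetric])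
      finally have "\<bar>A J\<bar> \<le> M * (\<omega> * R' powr n) / (\<omega> * \<rho> J powr n)"
        using \<omega> \<rho>[of J] M0 by (subst (asm) ennreal_le_iff) auto
      also have "\<dots> = M * R' powr n / r powr n * (2 powr - n) ^ J"
        using \<omega> r by (simp add: \<rho>_def powr_mult powr_powr powr_minus powr_realpow[symmetric] field_simps)
      finally show ?thesis .
    qed
    have A0: "1 \<le> A 0"
    proof -
      interpret prob_space "m 0" by (rule m)
      have "AE x in m 0. 1 \<le> f x"
        unfolding m_def using f1 by (intro AE_uniform_measureI) (auto simp: \<rho>_def)
      then have "(\<integral>x. 1 \<partial>m 0) \<le> (\<integral>x. f x \<partial>m 0)" using int by (intro integral_mono_AE) auto
      then show ?thesis unfolding A_def by (simp add: prob_space)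
    qed
    have H: "H \<ge> 0" unfolding H_def by simp
    have tele: "A 0 - A J \<le> H / (1 - q)" for J
    proof -
      have "A 0 - A J = (\<Sum>j<J. A j - A (Suc j))" by (simp add: sum_lessThan_telescope')
      also have "\<dots> \<le> (\<Sum>j<J. H * q ^ j)"
        by (intro sum_mono) (use step in \<open>simp add: abs_le_iff\<close>)
      also have "\<dots> \<le> (\<Sum>j. H * q ^ j)"
        using H q by (intro sum_le_suminf summable_mult summable_geometric) auto
      also have "\<dots> = H / (1 - q)" using q by (simp add: suminf_mult suminf_geometric)
      finally show ?thesis .
    qed
    have "(\<lambda>J. M * R' powr n / r powr n * (2 powr - n) ^ J) \<longlonglongrightarrow> M * R' powr n / r powr n * 0"
      using n0 by (intro tendsto_mult_left LIMSEQ_power_zero) (simp add: powr_less_one)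
    then have "A \<longlonglongrightarrow> 0"
      using Abd by (intro Lim_null_comparison[of A]) auto
    then have "(\<lambda>J. A 0 - A J) \<longlonglongrightarrow> A 0 - 0" by (intro tendsto_diff tendsto_const)
    then have "A 0 \<le> H / (1 - q)" using tele by (intro LIMSEQ_le_const2) auto
    with A0 have "1 \<le> H / (1 - q)" by simp
    then have "1 - q \<le> H" using q by (simp add: field_simps)
    then have "(1 - q) powr p \<le> H powr p" using q sp by (intro powr_mono2) auto
    also have "H powr p = D * e * r powr (s * p - n)"
      unfolding H_def using sp D real by (simp add: powr_powr)
    finally have "(1 - q) powr p * r powr (n - s * p) \<le> D * e * (r powr (s * p - n) * r powr (n - s * p))"
      unfolding mult.assoc[symmetric] by (rule mult_right_mono) simp
    also have "r powr (s * p - n) * r powr (n - s * p) = 1" using r by (simp add: powr_add[symmetric])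
    finally have "r powr (n - s * p) \<le> C * e"
      using q D by (simp add: C_def field_simps)
    then show ?thesis using real C by (simp add: ennreal_mult[symmetric] ennreal_leI)
  qed
  show ?thesis using main C unfolding n_def by (intro exI[of _ C]) blast
qed

lemma zero_ext_bounds:
  fixes G :: "'a::euclidean_space set"
  assumes G: "open G" and u: "u \<in> compactly_supported G"
  obtains M R where "\<And>x. \<bar>zero_ext G u x\<bar> \<le> M" "\<And>x. x \<notin> ball 0 R \<Longrightarrow> zero_ext G u x = 0"
proof -
  let ?S = "closure {x\<in>G. u x \<noteq> 0}"
  have S: "compact ?S" using u by (simp add: compactly_supported_def)
  have out: "zero_ext G u x = 0" if "x \<notin> ?S" for x
    using that closure_subset[of "{x\<in>G. u x \<noteq> 0}"] by (auto simp: zero_ext_def)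
  have "bounded (zero_ext G u ` ?S)"
    using S continuous_on_subset[OF continuous_on_zero_ext[OF G u]]
    by (intro compact_imp_bounded compact_continuous_image) auto
  then obtain M where M: "\<And>x. x \<in> ?S \<Longrightarrow> \<bar>zero_ext G u x\<bar> \<le> M" unfolding bounded_iff by auto
  obtain R where R: "?S \<subseteq> ball 0 R" using bounded_subset_ballD[OF compact_imp_bounded[OF S]] by blast
  have "\<bar>zero_ext G u x\<bar> \<le> max M 0" for x
    using M[of x] out[of x] by (cases "x \<in> ?S") auto
  moreover have "zero_ext G u x = 0" if "x \<notin> ball 0 R" for x using out R that by blast
  ultimately show ?thesis by (rule that)
qed

text \<open>The growing balls leave \<open>G\<close>, so the lower bound concerns the energy on the
  whole space, and the zero extension leads back to \<open>G\<close>. A cube contains the ball of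
  half its side about its centre; \<open>k = 2^(n - sp)\<close> compensates for the halving.\<close>

lemma (in whitney) capacity_cube_ge:
  assumes sp: "0 < s" "1 < p" "s * p < real CARD('n)" and Z: "admits_zero_extension s p G"
  shows "\<exists>C>0. \<forall>Q\<in>W. ennreal (side Q powr (real CARD('n) - s * p)) \<le> ennreal C * capacity s p Q G"
proof -
  have p0: "0 < p" using sp by simp
  obtain C where C: "C > 0" "\<And>u. u \<in> compactly_supported G \<Longrightarrow>
      gagliardo_energy s p UNIV (zero_ext G u) \<le> ennreal C * gagliardo_energy s p G u"
    using Z unfolding admits_zero_extension_iff[OF p0] by auto
  obtain B where B: "B > 0" "\<And>f (z :: real^'n) r M R. f \<in> borel_measurable borel \<Longrightarrow> (\<And>x. \<bar>f x\<bar> \<le> M) \<Longrightarrow>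
      (\<And>x. x \<notin> ball 0 R \<Longrightarrow> f x = 0) \<Longrightarrow> 0 < r \<Longrightarrow> (\<And>x. x \<in> ball z r \<Longrightarrow> 1 \<le> f x) \<Longrightarrow>
      ennreal (r powr (real CARD('n) - s * p)) \<le> ennreal B * gagliardo_energy s p UNIV f"
    using gagliardo_energy_ge_of_ball[OF sp] by metis
  define k where "k = 2 powr (real CARD('n) - s * p)"
  have k: "k > 0" by (simp add: k_def)
  have "ennreal (side Q powr (real CARD('n) - s * p)) \<le> ennreal (k * (B * C)) * capacity s p Q G" if Q: "Q \<in> W" for Q
  proof (rule le_capacityI[OF p0])
    fix u assume u: "u \<in> compactly_supported G" "\<And>x. x \<in> Q \<Longrightarrow> u x \<ge> 1"
    obtain z where z: "ball z (side Q / 2) \<subseteq> Q" using dyadic_cube_contains_ball[OF dyadic[OF Q]] .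
    obtain M R where MR: "\<And>x. \<bar>zero_ext G u x\<bar> \<le> M" "\<And>x. x \<notin> ball 0 R \<Longrightarrow> zero_ext G u x = 0"
      using zero_ext_bounds[OF G(1) u(1)] by blast
    have "ennreal ((side Q / 2) powr (real CARD('n) - s * p)) \<le> ennreal B * gagliardo_energy s p UNIV (zero_ext G u)"
    proof (rule B(2)[OF _ MR])
      show "zero_ext G u \<in> borel_measurable borel"
        by (intro borel_measurable_continuous_onI continuous_on_zero_ext G(1) u(1))
      show "1 \<le> zero_ext G u x" if "x \<in> ball z (side Q / 2)" for x
        using that z u(2) Q Union_cubes by (force simp: zero_ext_def)
    qed (use side_pos[OF Q] in auto)
    also have "\<dots> \<le> ennreal B * (ennreal C * gagliardo_energy s p G u)"
      using C(2)[OF u(1)] by (intro mult_left_mono) auto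
    finally have "ennreal k * ennreal ((side Q / 2) powr (real CARD('n) - s * p))
      \<le> ennreal k * (ennreal B * (ennreal C * gagliardo_energy s p G u))"
      by (rule mult_left_mono) simp
    moreover have "k * (side Q / 2) powr (real CARD('n) - s * p) = side Q powr (real CARD('n) - s * p)"
      using side_pos[OF Q] by (simp add: k_def powr_divide)
    ultimately show "ennreal (side Q powr (real CARD('n) - s * p)) \<le> ennreal (k * (B * C)) * gagliardo_energy s p G u"
      using k B(1) C(1) by (simp add: ennreal_mult mult.assoc ennreal_mult[symmetric, of k])
  qed (use k B(1) C(1) in auto)
  then show ?thesis using k B(1) C(1) by (intro exI[of _ "k * (B * C)"]) auto
qed

section \<open>Dyadic layers and local averages\<close>

text \<open>The slice of \<open>t\<close> between 2^k and 2^(k+1): it vanishes up to 2^k and is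
  constantly 2^k from 2^(k+1) on. The slices of a positive number over all integers \<open>k\<close>
  add up to that number.\<close>

definition dyadic_layer :: "int \<Rightarrow> real \<Rightarrow> real" where
  "dyadic_layer k t = min (2 powr k) (max 0 (t - 2 powr k))"

lemma dyadic_layer_mono: "a \<le> b \<Longrightarrow> dyadic_layer k a \<le> dyadic_layer k b"
  unfolding dyadic_layer_def by auto

lemma sum_dyadic_layer:
  "(\<Sum>j<N. dyadic_layer (m + int j) t) = min (2 powr (m + int N) - 2 powr m) (max 0 (t - 2 powr m))"
proof (induction N)
  case (Suc N)
  have two: "2 powr (m + int (Suc N)) = 2 * (2::real) powr (m + int N)"
    by (simp add: powr_add add.assoc[symmetric])
  have "(2::real) powr m \<le> 2 powr (m + int N)" by (intro powr_mono) auto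
  moreover have "min (A - B) (max 0 (t - B)) + min A (max 0 (t - A)) = min (2 * A - B) (max 0 (t - B))"
    if "B \<le> A" "0 < B" for A B :: real
    using that by (auto simp: min_def max_def)
  ultimately show ?case
    unfolding sum.lessThan_Suc Suc.IH two by (simp add: dyadic_layer_def)
qed simp

lemma sum_dyadic_layer_diff_le:
  assumes I: "finite I"
  shows "(\<Sum>k\<in>I. \<bar>dyadic_layer k a - dyadic_layer k b\<bar>) \<le> \<bar>a - b\<bar>"
proof -
  have main: "(\<Sum>k\<in>I. \<bar>dyadic_layer k a - dyadic_layer k b\<bar>) \<le> a - b" if "b \<le> a" for a b
  proof -
    obtain m M where mM: "I \<subseteq> {m..<M}"
    proof -
      \<comment> \<open>Inserting 0 keeps \<open>Min\<close> and \<open>Max\<close> meaningful when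
        \<open>I\<close> is empty.\<close>
      have "I \<subseteq> {Min (insert 0 I)..<Max (insert 0 I) + 1}" using I by (auto simp: le_less_trans zless_add1_eq le_less[symmetric])
      then show ?thesis by (rule that)
    qed
    define N where "N = nat (M - m)"
    have "I \<subseteq> (\<lambda>j. m + int j) ` {..<N}"
    proof
      fix k assume "k \<in> I"
      then have "m \<le> k" "k < M" using mM by auto
      then have "k = m + int (nat (k - m))" "nat (k - m) < N" unfolding N_def by auto
      then show "k \<in> (\<lambda>j. m + int j) ` {..<N}" by blast
    qed
    then have "(\<Sum>k\<in>I. \<bar>dyadic_layer k a - dyadic_layer k b\<bar>)
        \<le> (\<Sum>k\<in>(\<lambda>j. m + int j) ` {..<N}. \<bar>dyadic_layer k a - dyadic_layer k b\<bar>)"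
      by (intro sum_mono2) auto
    also have "\<dots> = (\<Sum>j<N. \<bar>dyadic_layer (m + int j) a - dyadic_layer (m + int j) b\<bar>)"
      by (subst sum.reindex) (auto simp: inj_on_def)
    also have "\<dots> = (\<Sum>j<N. dyadic_layer (m + int j) a) - (\<Sum>j<N. dyadic_layer (m + int j) b)"
      using dyadic_layer_mono[OF that] by (simp add: sum_subtractf[symmetric])
    also have "\<dots> \<le> a - b"
      unfolding sum_dyadic_layer using that by (auto simp: min_def max_def)
    finally show ?thesis .
  qed
  show ?thesis
  proof (cases "b \<le> a")
    case False
    then show ?thesis using main[of a b] by (simp add: abs_minus_commute)
  qed (use main[of b a] in simp)
qed

text \<open>Each increment is at most |a - b|; taking out the power p - 1 of this bound reduces the
  claim to exponent 1. Integrated, it allows the energies of all layers to be added without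
  loss.\<close>

lemma sum_dyadic_layer_diff_powr_le:
  assumes I: "finite I" and p: "1 \<le> p"
  shows "(\<Sum>k\<in>I. \<bar>dyadic_layer k a - dyadic_layer k b\<bar> powr p) \<le> \<bar>a - b\<bar> powr p"
proof (cases "a = b")
  case False
  have "\<bar>dyadic_layer k a - dyadic_layer k b\<bar> powr p \<le> \<bar>a - b\<bar> powr (p - 1) * \<bar>dyadic_layer k a - dyadic_layer k b\<bar>" for k
  proof -
    have "\<bar>dyadic_layer k a - dyadic_layer k b\<bar> \<le> \<bar>a - b\<bar>"
      using sum_dyadic_layer_diff_le[of "{k}" a b] by simp
    then have "\<bar>dyadic_layer k a - dyadic_layer k b\<bar> powr (p - 1) \<le> \<bar>a - b\<bar> powr (p - 1)"
      using p by (intro powr_mono2) auto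
    moreover have "\<bar>dyadic_layer k a - dyadic_layer k b\<bar> powr p
      = \<bar>dyadic_layer k a - dyadic_layer k b\<bar> powr (p - 1) * \<bar>dyadic_layer k a - dyadic_layer k b\<bar>"
      using p by (cases "dyadic_layer k a = dyadic_layer k b") (auto simp: powr_diff)
    ultimately show ?thesis by (simp add: mult_right_mono)
  qed
  then have "(\<Sum>k\<in>I. \<bar>dyadic_layer k a - dyadic_layer k b\<bar> powr p)
    \<le> \<bar>a - b\<bar> powr (p - 1) * (\<Sum>k\<in>I. \<bar>dyadic_layer k a - dyadic_layer k b\<bar>)"
    unfolding sum_distrib_left by (rule sum_mono)
  also have "\<dots> \<le> \<bar>a - b\<bar> powr (p - 1) * \<bar>a - b\<bar>"
    using sum_dyadic_layer_diff_le[OF I] by (intro mult_left_mono) auto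
  also have "\<dots> = \<bar>a - b\<bar> powr p" using False by (simp add: powr_diff)
  finally show ?thesis .
qed (use p in auto)

text \<open>Monotone convergence along an enumeration of \<open>W\<close>. It is needed because weak
  quasiadditivity speaks of finite families only, so the estimates over cubes are obtained for
  finite families first.\<close>

lemma nn_integral_Union_le:
  assumes W: "countable W" and meas: "\<And>Q. Q \<in> W \<Longrightarrow> Q \<in> sets M"
    and h[measurable]: "h \<in> borel_measurable M"
    and le: "\<And>F. finite F \<Longrightarrow> F \<subseteq> W \<Longrightarrow> (\<integral>\<^sup>+x\<in>\<Union>F. h x \<partial>M) \<le> X"
  shows "(\<integral>\<^sup>+x\<in>\<Union>W. h x \<partial>M) \<le> X"
proof (cases "W = {}")
  case False
  define F where "F i = from_nat_into W ` {..i}" for i :: nat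
  have F: "finite (F i)" "F i \<subseteq> W" for i
    using from_nat_into[OF False] by (auto simp: F_def)
  have [measurable]: "\<Union>(F i) \<in> sets M" for i using F meas by (intro sets.finite_Union) auto
  have mono: "mono (\<lambda>i x. h x * indicator (\<Union>(F i)) x)"
    by (intro monoI le_funI mult_left_mono) (auto simp: F_def indicator_def)
  have "(\<integral>\<^sup>+x\<in>\<Union>W. h x \<partial>M) \<le> (\<integral>\<^sup>+x. (SUP i. h x * indicator (\<Union>(F i)) x) \<partial>M)"
  proof (rule nn_integral_mono)
    fix x
    show "h x * indicator (\<Union>W) x \<le> (SUP i. h x * indicator (\<Union>(F i)) x)"
    proof (cases "x \<in> \<Union>W")
      case True
      then obtain Q where Q: "Q \<in> W" "x \<in> Q" by auto
      then obtain i where "from_nat_into W i = Q" using from_nat_into_surj[OF W] by metis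
      then have "x \<in> \<Union>(F i)" using Q by (auto simp: F_def)
      then have "h x * indicator (\<Union>W) x = h x * indicator (\<Union>(F i)) x" using True by simp
      also have "\<dots> \<le> (SUP i. h x * indicator (\<Union>(F i)) x)" by (rule SUP_upper) simp
      finally show ?thesis .
    qed simp
  qed
  also have "\<dots> = (SUP i. \<integral>\<^sup>+x. h x * indicator (\<Union>(F i)) x \<partial>M)"
    by (rule nn_integral_monotone_convergence_SUP) (use mono in \<open>auto simp: incseq_def mono_def\<close>)
  also have "\<dots> \<le> X" using le F by (intro SUP_least) auto
  finally show ?thesis .
qed simp

lemma countable_dyadic_cubes: "countable {Q :: (real^'n) set. dyadic_cube Q}"
proof -
  have "{Q :: (real^'n) set. dyadic_cube Q} \<subseteq>
    range (\<lambda>(k :: int, m :: 'n \<Rightarrow> int). cbox (\<chi> i. 2 powi k * of_int (m i)) (\<chi> i. 2 powi k * (of_int (m i) + 1)))"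
    by (auto simp: dyadic_cube_def)
  then show ?thesis by (rule countable_subset) simp
qed

section \<open>Averages at the scale of the distance to the boundary\<close>

context whitney
begin

text \<open>The distance is 1-Lipschitz, so for |z| < 1 the factor 1/2 makes this map in
  \<open>x\<close> the identity plus a perturbation with Lipschitz constant at most 1/2: distances
  change by factors between 1/2 and 3/2. The same factor keeps points of \<open>G\<close> in
  \<open>G\<close>.\<close>

definition local_shift :: "real^'n \<Rightarrow> real^'n \<Rightarrow> real^'n" where
  "local_shift z x = x + (d x / 2) *\<^sub>R z"

text \<open>On \<open>G\<close> this is the average over the ball of radius d(x)/2 about
  \<open>x\<close>, written over the fixed unit ball. The measure then does not depend on
  \<open>x\<close>, so a difference of averages is the average of the differences at equal
  \<open>z\<close>.\<close>

definition local_average :: "(real^'n \<Rightarrow> real) \<Rightarrow> real^'n \<Rightarrow> real" where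
  "local_average f x = (\<integral>z. f (local_shift z x) \<partial>uniform_measure lborel (ball 0 1))"

lemma measurable_local_shift [measurable]:
  assumes [measurable]: "g \<in> borel_measurable M" "h \<in> borel_measurable M"
  shows "(\<lambda>w. local_shift (g w) (h w)) \<in> borel_measurable M"
proof -
  have [measurable]: "d \<in> borel_measurable borel"
    by (intro borel_measurable_continuous_onI continuous_intros)
  show ?thesis unfolding local_shift_def by measurable
qed

lemma local_shift_diff:
  assumes z: "norm z < 1"
  shows "norm ((local_shift z x - local_shift z y) - (x - y)) \<le> norm (x - y) / 2"
proof -
  have "(local_shift z x - local_shift z y) - (x - y) = ((d x - d y) / 2) *\<^sub>R z"
    by (simp add: local_shift_def algebra_simps diff_divide_distrib)
  then have "norm ((local_shift z x - local_shift z y) - (x - y)) = \<bar>d x - d y\<bar> / 2 * norm z" by simp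
  also have "\<dots> \<le> norm (x - y) / 2 * 1"
    using infdist_triangle_abs[of x "frontier G" y] z by (intro mult_mono) (auto simp: dist_norm)
  finally show ?thesis by simp
qed

lemma local_shift_upper:
  assumes "norm z < 1"
  shows "norm (local_shift z x - local_shift z y) \<le> 3 / 2 * norm (x - y)"
  using local_shift_diff[OF assms, of x y] norm_triangle_ineq2[of "local_shift z x - local_shift z y" "x - y"]
  by linarith

lemma local_shift_lower:
  assumes "norm z < 1"
  shows "1 / 2 * dist x y \<le> dist (local_shift z x) (local_shift z y)"
  using local_shift_diff[OF assms, of x y] norm_triangle_ineq2[of "x - y" "local_shift z x - local_shift z y"]
  unfolding dist_norm by (simp add: norm_minus_commute)

lemma dist_local_shift:
  assumes "norm z < 1"
  shows "dist x (local_shift z x) \<le> d x / 2"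
  using assms infdist_nonneg[of x "frontier G"] mult_left_le[of "norm z" "d x"]
  by (simp add: local_shift_def dist_norm)

lemma local_shift_in:
  assumes "norm z < 1" "x \<in> G"
  shows "local_shift z x \<in> G"
proof (rule ccontr)
  assume "local_shift z x \<notin> G"
  then have "d x \<le> d x / 2"
    using infdist_frontier_le_dist[OF assms(2)] dist_local_shift[OF assms(1), of x] by fastforce
  then show False using d_pos[OF assms(2)] by simp
qed

lemma prob_space_unit_ball: "prob_space (uniform_measure lborel (ball (0::real^'n) 1))"
  by (rule prob_space_uniform_ball) simp

lemma integrable_local_shift:
  fixes M :: real
  assumes [measurable]: "f \<in> borel_measurable borel" and M: "\<And>x. \<bar>f x\<bar> \<le> M"
  shows "integrable (uniform_measure lborel (ball 0 1)) (\<lambda>z. f (local_shift z x))"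
proof -
  interpret prob_space "uniform_measure lborel (ball (0::real^'n) 1)" by (rule prob_space_unit_ball)
  show ?thesis using M by (intro integrable_const_bound[of _ M]) auto
qed

lemma continuous_on_local_average:
  assumes f: "continuous_on UNIV f" and M: "\<And>x. \<bar>f x\<bar> \<le> M"
  shows "continuous_on UNIV (local_average f)"
proof (rule continuous_on_sequentiallyI)
  fix X :: "nat \<Rightarrow> real^'n" and a
  assume X: "X \<longlonglongrightarrow> a"
  interpret prob_space "uniform_measure lborel (ball (0::real^'n) 1)" by (rule prob_space_unit_ball)
  have [measurable]: "f \<in> borel_measurable borel" using f by (rule borel_measurable_continuous_onI)
  show "(\<lambda>n. local_average f (X n)) \<longlonglongrightarrow> local_average f a"
    unfolding local_average_def
  proof (rule integral_dominated_convergence[where w = "\<lambda>_. M"])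
    show "AE z in uniform_measure lborel (ball 0 1). (\<lambda>n. f (local_shift z (X n))) \<longlonglongrightarrow> f (local_shift z a)"
    proof (rule AE_I2)
      fix z :: "real^'n"
      have "(\<lambda>n. local_shift z (X n)) \<longlonglongrightarrow> local_shift z a"
        unfolding local_shift_def using X by (intro tendsto_intros) auto
      moreover have "isCont f (local_shift z a)" using f by (simp add: continuous_on_eq_continuous_at)
      ultimately show "(\<lambda>n. f (local_shift z (X n))) \<longlonglongrightarrow> f (local_shift z a)"
        by (rule isCont_tendsto_compose[rotated])
    qed
  qed (use M in auto)
qed

text \<open>A nonzero average at \<open>x\<close> forces a point \<open>y\<close> of the support
  within d(x)/2 of \<open>x\<close>. The set \<open>K\<close> of such \<open>x\<close> is closed. It
  contains no point outside \<open>G\<close>, since there |x - y| would be at least d(x) + d(y), and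
  the factor 1/2 makes it bounded.\<close>

lemma local_average_compactly_supported:
  assumes u: "u \<in> compactly_supported G"
  shows "local_average (zero_ext G u) \<in> compactly_supported G"
proof -
  let ?f = "zero_ext G u" and ?S = "closure {x\<in>G. u x \<noteq> 0}"
  obtain M R where M: "\<And>x. \<bar>?f x\<bar> \<le> M" using zero_ext_bounds[OF G(1) u] by blast
  have cont: "continuous_on UNIV ?f" by (rule continuous_on_zero_ext[OF G(1) u])
  have S: "compact ?S" "?S \<subseteq> G" using u by (auto simp: compactly_supported_def)
  have contv: "continuous_on UNIV (local_average ?f)" by (rule continuous_on_local_average[OF cont M])
  have nz: "\<exists>y\<in>?S. dist x y \<le> d x / 2" if "local_average ?f x \<noteq> 0" for x
  proof (rule ccontr)
    assume no: "\<not> ?thesis"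
    have "AE z in uniform_measure lborel (ball 0 1). ?f (local_shift z x) = 0"
    proof (rule AE_uniform_measureI, simp, rule AE_I2, rule impI)
      fix z :: "real^'n" assume "z \<in> ball 0 1"
      then have "dist x (local_shift z x) \<le> d x / 2" by (intro dist_local_shift) simp
      then have "local_shift z x \<notin> ?S" using no by auto
      then show "?f (local_shift z x) = 0"
        using closure_subset[of "{x\<in>G. u x \<noteq> 0}"] by (auto simp: zero_ext_def)
    qed
    then have "local_average ?f x = 0" unfolding local_average_def by (rule integral_eq_zero_AE)
    with that show False by simp
  qed
  \<comment> \<open>By convention \<open>infdist\<close> to the empty set is 0, so for an empty
    support the set \<open>K\<close> of the other case would be the whole space.\<close>
  show ?thesis
  proof (cases "?S = {}")
    case True
    have "local_average ?f x = 0" for x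
    proof (rule ccontr)
      assume "local_average ?f x \<noteq> 0"
      from nz[OF this] True show False by (metis empty_iff)
    qed
    then show ?thesis unfolding compactly_supported_def
      using continuous_on_subset[OF contv] by simp
  next
    case False
    define K where "K = {x. infdist x ?S \<le> d x / 2}"
    have attain: "\<exists>y\<in>?S. dist x y \<le> d x / 2" if "x \<in> K" for x
      using infdist_attains_inf[OF closed_closure False, of x] that by (force simp: K_def)
    have clK: "closed K" unfolding K_def by (intro closed_Collect_le continuous_intros) auto
    have KG: "K \<subseteq> G"
    proof
      fix x assume "x \<in> K"
      then obtain y where y: "y \<in> ?S" "dist x y \<le> d x / 2" using attain by blast
      show "x \<in> G"
      proof (rule ccontr)
        assume "x \<notin> G"
        then have "d y + d x \<le> dist x y"
          using infdist_frontier_add_le_dist[of y G x] y S(2) by (auto simp: dist_commute)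
        moreover have "d y > 0" "d x \<ge> 0" using d_pos y S(2) infdist_nonneg by auto
        ultimately show False using y by linarith
      qed
    qed
    obtain B where B: "?S \<subseteq> ball 0 B" using bounded_subset_ballD[OF compact_imp_bounded[OF S(1)]] by blast
    obtain w where w: "w \<in> frontier G" using frontier_nonempty_of_proper[OF G(2,3)] by auto
    have "bounded K" unfolding bounded_iff
    proof (intro exI ballI)
      fix x assume "x \<in> K"
      then obtain y where y: "y \<in> ?S" "dist x y \<le> d x / 2" using attain by blast
      have "norm y < B" using y B by auto
      moreover have "d y \<le> norm y + norm w" using infdist_le[OF w, of y] norm_triangle_ineq4[of y w] by (simp add: dist_norm)
      moreover have "d x \<le> d y + dist x y" by (rule infdist_triangle)
      moreover have "norm x \<le> norm y + dist x y" using norm_triangle_ineq2[of x y] by (simp add: dist_norm)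
      \<comment> \<open>From |x - y| <= d(x)/2 and d(x) <= d(y) + |x - y| it follows that |x - y| <=
        d(y) <= |y| + |w|.\<close>
      ultimately show "norm x \<le> 2 * B + norm w" using y by linarith
    qed
    then have K: "compact K" using clK by (simp add: compact_eq_bounded_closed)
    have "{x\<in>G. local_average ?f x \<noteq> 0} \<subseteq> K"
    proof
      fix x assume "x \<in> {x\<in>G. local_average ?f x \<noteq> 0}"
      then have "local_average ?f x \<noteq> 0" by simp
      from nz[OF this] show "x \<in> K" unfolding K_def by (metis (mono_tags, lifting) infdist_le2 mem_Collect_eq)
    qed
    then have sub: "closure {x\<in>G. local_average ?f x \<noteq> 0} \<subseteq> K" using clK by (rule closure_minimal)
    have "compact (closure {x\<in>G. local_average ?f x \<noteq> 0})"
      using closed_Int_compact[OF closed_closure K, of "{x\<in>G. local_average ?f x \<noteq> 0}"] sub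
      by (simp only: Int_absorb2)
    then show ?thesis unfolding compactly_supported_def
      using continuous_on_subset[OF contv subset_UNIV[of G]] sub KG by auto
  qed
qed

text \<open>
  Jensen's inequality transfers the energy to \<open>local_shift z\<close> for each fixed \<open>z\<close>, and these maps
  are bi-Lipschitz uniformly in \<open>z\<close>.
\<close>

lemma gagliardo_energy_local_average_le:
  assumes sp: "0 < s" "1 < p"
  shows "\<exists>C>0. \<forall>f M. f \<in> borel_measurable borel \<and> (\<forall>x. \<bar>f x\<bar> \<le> M) \<longrightarrow>
    gagliardo_energy s p G (local_average f) \<le> ennreal C * gagliardo_energy s p G f"
proof -
  define n where "n = real CARD('n)"
  define \<omega> where "\<omega> = unit_ball_vol n"
  have \<omega>: "\<omega> > 0" unfolding \<omega>_def n_def by simp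
  have n0: "n > 0" unfolding n_def by simp
  \<comment> \<open>\<open>C\<close> is the volume factor of a map that contracts distances at most
    by half, and it is paid once for each variable. The factor \<open>k\<close> below is the loss in
    the kernel, as the shifts stretch distances by at most 3/2.\<close>
  define C where "C = \<omega> * (n / (1 / 2)) ^ CARD('n)"
  have C: "C > 0" unfolding C_def using \<omega> n0 by simp
  define k where "k = (3 / 2) powr (n + s * p)"
  have k: "k > 0" by (simp add: k_def)
  have [measurable]: "G \<in> sets borel" using G(1) by simp
  have [measurable]: "ball (0::real^'n) 1 \<in> sets borel" by simp
  have ball: "emeasure lborel (ball (0::real^'n) 1) = ennreal \<omega>"
    using emeasure_ball[of 1 "0::real^'n"] by (simp add: \<omega>_def n_def)
  have main: "gagliardo_energy s p G (local_average f) \<le> ennreal (k * C * C) * gagliardo_energy s p G f"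
    if [measurable]: "f \<in> borel_measurable borel" and M: "\<And>x. \<bar>f x\<bar> \<le> M" for f M
  proof -
    interpret prob_space "uniform_measure lborel (ball (0::real^'n) 1)" by (rule prob_space_unit_ball)
    define I where "I = gagliardo_integrand s p f"
    have [measurable]: "(\<lambda>w. I (g w) (h w)) \<in> borel_measurable N"
      if "g \<in> borel_measurable N" "h \<in> borel_measurable N" for g h and N :: "'x measure"
      unfolding I_def using that by measurable
    define J where "J x y z = I (local_shift z x) (local_shift z y) * indicator G y * indicator G x * indicator (ball 0 1) z" for x y z
    have pw: "gagliardo_integrand s p (local_average f) x y * indicator G y * indicator G x
        \<le> ennreal (k / \<omega>) * (\<integral>\<^sup>+z. J x y z \<partial>lborel)" for x y
    proof (cases "x \<in> G \<and> y \<in> G \<and> x \<noteq> y")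
      case True
      let ?r = "norm (x - y) powr (n + s * p)"
      have r: "?r > 0" using True by simp
      have "local_average f x - local_average f y = expectation (\<lambda>z. f (local_shift z x) - f (local_shift z y))"
        unfolding local_average_def using integrable_local_shift[OF that(1) M] by simp
      then have "ennreal (\<bar>local_average f x - local_average f y\<bar> powr p)
        \<le> (\<integral>\<^sup>+z. ennreal (\<bar>f (local_shift z x) - f (local_shift z y)\<bar> powr p) \<partial>uniform_measure lborel (ball 0 1))"
        using abs_expectation_powr_le[OF sp(2), of "\<lambda>z. f (local_shift z x) - f (local_shift z y)"]
          integrable_local_shift[OF that(1) M] by (simp del: Bochner_Integration.integral_diff)
      also have "\<dots> = (\<integral>\<^sup>+z\<in>ball 0 1. ennreal (\<bar>f (local_shift z x) - f (local_shift z y)\<bar> powr p) \<partial>lborel) / ennreal \<omega>"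
        by (subst nn_integral_uniform_measure) (auto simp: ball)
      also have "(\<integral>\<^sup>+z\<in>ball 0 1. ennreal (\<bar>f (local_shift z x) - f (local_shift z y)\<bar> powr p) \<partial>lborel)
          \<le> (\<integral>\<^sup>+z. ennreal (k * ?r) * J x y z \<partial>lborel)"
      proof (rule nn_integral_mono)
        fix z :: "real^'n"
        show "ennreal (\<bar>f (local_shift z x) - f (local_shift z y)\<bar> powr p) * indicator (ball 0 1) z \<le> ennreal (k * ?r) * J x y z"
        proof (cases "z \<in> ball 0 1")
          case z: True
          then have z1: "norm z < 1" by simp
          let ?a = "local_shift z x" and ?b = "local_shift z y"
          have "0 < norm (x - y)" using True by simp
          then have pos: "0 < norm (?a - ?b)" using local_shift_lower[OF z1, of x y] unfolding dist_norm by linarith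
          have "norm (?a - ?b) powr (n + s * p) \<le> (3 / 2 * norm (x - y)) powr (n + s * p)"
            using local_shift_upper[OF z1, of x y] n0 sp by (intro powr_mono2) auto
          also have "\<dots> = k * ?r" by (simp only: k_def powr_mult)
          finally have "\<bar>f ?a - f ?b\<bar> powr p * norm (?a - ?b) powr (n + s * p) \<le> (k * ?r) * \<bar>f ?a - f ?b\<bar> powr p"
            by (subst mult.commute) (intro mult_right_mono, auto)
          then have "\<bar>f ?a - f ?b\<bar> powr p \<le> (k * ?r) * (\<bar>f ?a - f ?b\<bar> powr p / norm (?a - ?b) powr (n + s * p))"
            using pos by (simp add: field_simps)
          then have "ennreal (\<bar>f ?a - f ?b\<bar> powr p) \<le> ennreal (k * ?r) * I ?a ?b"
            unfolding I_def gagliardo_integrand_def n_def[symmetric] using k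
            by (subst ennreal_mult[symmetric]) (auto intro: ennreal_leI)
          then show ?thesis using True z by (simp add: J_def)
        qed simp
      qed
      also have "\<dots> = ennreal (k * ?r) * (\<integral>\<^sup>+z. J x y z \<partial>lborel)"
        unfolding J_def by (rule nn_integral_cmult) measurable
      finally have "ennreal (\<bar>local_average f x - local_average f y\<bar> powr p)
          \<le> ennreal (k * ?r) * (\<integral>\<^sup>+z. J x y z \<partial>lborel) / ennreal \<omega>"
        by (simp add: divide_right_mono_ennreal)
      then have "ennreal (1 / ?r) * ennreal (\<bar>local_average f x - local_average f y\<bar> powr p)
          \<le> ennreal (1 / ?r) * (ennreal (k * ?r) * (\<integral>\<^sup>+z. J x y z \<partial>lborel) / ennreal \<omega>)"
        by (rule mult_left_mono) simp
      also have "\<dots> = ennreal (1 / ?r) * ennreal (k * ?r) * ennreal (1 / \<omega>) * (\<integral>\<^sup>+z. J x y z \<partial>lborel)"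
        using \<omega> by (simp add: divide_ennreal_def inverse_ennreal mult_ac inverse_eq_divide)
      also have "ennreal (1 / ?r) * ennreal (k * ?r) * ennreal (1 / \<omega>) = ennreal (k / \<omega>)"
        using r k \<omega> by (simp add: ennreal_mult[symmetric])
      also have "ennreal (1 / ?r) * ennreal (\<bar>local_average f x - local_average f y\<bar> powr p) = gagliardo_integrand s p (local_average f) x y"
        unfolding gagliardo_integrand_def n_def by (simp add: ennreal_mult[symmetric])
      finally show ?thesis using True by simp
    qed (auto simp: gagliardo_integrand_def)
    define \<Phi> where "\<Phi> a = (\<integral>\<^sup>+b. I a b * indicator G b \<partial>lborel)" for a
    have [measurable]: "\<Phi> \<in> borel_measurable borel" unfolding \<Phi>_def by measurable
    \<comment> \<open>For fixed \<open>z\<close>, the inner variable is transformed with the outer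
      one frozen; the outer one follows through \<open>\<Phi>\<close>.\<close>
    have fixed: "(\<integral>\<^sup>+x. \<integral>\<^sup>+y. J x y z \<partial>lborel \<partial>lborel) \<le> ennreal (C * C) * gagliardo_energy s p G f * indicator (ball 0 1) z" for z
    proof (cases "z \<in> ball 0 1")
      case True
      then have z: "norm z < 1" by simp
      have cv: "(\<integral>\<^sup>+x. h (local_shift z x) \<partial>lborel) \<le> ennreal C * (\<integral>\<^sup>+x. h x \<partial>lborel)" if "h \<in> borel_measurable borel" for h
      proof -
        have "continuous_on UNIV (local_shift z)"
          unfolding local_shift_def by (intro continuous_intros) auto
        then show ?thesis
          using nn_integral_expanding_le[of "1/2" "local_shift z" h, OF _ local_shift_lower[OF z] _ that]
          unfolding C_def \<omega>_def n_def by simp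
      qed
      have "(\<integral>\<^sup>+x. \<integral>\<^sup>+y. J x y z \<partial>lborel \<partial>lborel) \<le> (\<integral>\<^sup>+x. ennreal C * (\<Phi> (local_shift z x) * indicator G (local_shift z x)) \<partial>lborel)"
      proof (rule nn_integral_mono)
        fix x
        show "(\<integral>\<^sup>+y. J x y z \<partial>lborel) \<le> ennreal C * (\<Phi> (local_shift z x) * indicator G (local_shift z x))"
        proof (cases "x \<in> G")
          case x: True
          have "(\<integral>\<^sup>+y. J x y z \<partial>lborel) \<le> (\<integral>\<^sup>+y. I (local_shift z x) (local_shift z y) * indicator G (local_shift z y) \<partial>lborel)"
            using local_shift_in[OF z] by (intro nn_integral_mono) (auto simp: J_def indicator_def)
          also have "\<dots> \<le> ennreal C * \<Phi> (local_shift z x)"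
            unfolding \<Phi>_def by (rule cv) measurable
          finally show ?thesis using local_shift_in[OF z x] by simp
        qed (simp add: J_def)
      qed
      also have "\<dots> = ennreal C * (\<integral>\<^sup>+x. \<Phi> (local_shift z x) * indicator G (local_shift z x) \<partial>lborel)"
        by (rule nn_integral_cmult) measurable
      also have "\<dots> \<le> ennreal C * (ennreal C * (\<integral>\<^sup>+x. \<Phi> x * indicator G x \<partial>lborel))"
        by (intro mult_left_mono cv) auto
      also have "(\<integral>\<^sup>+x. \<Phi> x * indicator G x \<partial>lborel) = gagliardo_energy s p G f"
        by (simp add: gagliardo_energy_eq \<Phi>_def I_def)
      finally show ?thesis using True C by (simp add: ennreal_mult mult.assoc)
    qed (simp add: J_def)
    have [measurable]: "(\<lambda>w. J (g1 w) (g2 w) (g3 w)) \<in> borel_measurable N"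
      if "g1 \<in> borel_measurable N" "g2 \<in> borel_measurable N" "g3 \<in> borel_measurable N" for g1 g2 g3 and N :: "'y measure"
      unfolding J_def using that by measurable
    have "gagliardo_energy s p G (local_average f)
      = (\<integral>\<^sup>+x. \<integral>\<^sup>+y. gagliardo_integrand s p (local_average f) x y * indicator G y * indicator G x \<partial>lborel \<partial>lborel)"
      unfolding gagliardo_energy_eq by (intro nn_integral_cong) (auto simp: indicator_def)
    also have "\<dots> \<le> (\<integral>\<^sup>+x. \<integral>\<^sup>+y. ennreal (k / \<omega>) * (\<integral>\<^sup>+z. J x y z \<partial>lborel) \<partial>lborel \<partial>lborel)"
      by (intro nn_integral_mono pw)
    also have "\<dots> = ennreal (k / \<omega>) * (\<integral>\<^sup>+x. \<integral>\<^sup>+y. \<integral>\<^sup>+z. J x y z \<partial>lborel \<partial>lborel \<partial>lborel)"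
      by (simp add: nn_integral_cmult)
    also have "(\<integral>\<^sup>+x. \<integral>\<^sup>+y. \<integral>\<^sup>+z. J x y z \<partial>lborel \<partial>lborel \<partial>lborel) = (\<integral>\<^sup>+x. \<integral>\<^sup>+z. \<integral>\<^sup>+y. J x y z \<partial>lborel \<partial>lborel \<partial>lborel)"
      by (intro nn_integral_cong lborel_pair.Fubini') measurable
    also have "\<dots> = (\<integral>\<^sup>+z. \<integral>\<^sup>+x. \<integral>\<^sup>+y. J x y z \<partial>lborel \<partial>lborel \<partial>lborel)"
      by (intro lborel_pair.Fubini') measurable
    also have "\<dots> \<le> (\<integral>\<^sup>+z. ennreal (C * C) * gagliardo_energy s p G f * indicator (ball (0::real^'n) 1) z \<partial>lborel)"
      by (intro nn_integral_mono fixed)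
    also have "\<dots> = ennreal (C * C) * gagliardo_energy s p G f * ennreal \<omega>"
      by (subst nn_integral_cmult_indicator) (auto simp: ball)
    finally have "gagliardo_energy s p G (local_average f) \<le> ennreal (k / \<omega>) * (ennreal (C * C) * gagliardo_energy s p G f * ennreal \<omega>)"
      by (simp add: mult_left_mono)
    also have "\<dots> = (ennreal (k / \<omega>) * ennreal (C * C) * ennreal \<omega>) * gagliardo_energy s p G f"
      by (simp add: mult_ac)
    also have "ennreal (k / \<omega>) * ennreal (C * C) * ennreal \<omega> = ennreal (k * C * C)"
      using k C \<omega> by (simp add: ennreal_mult[symmetric])
    finally show ?thesis .
  qed
  show ?thesis using main k C by (intro exI[of _ "k * C * C"]) auto
qed

text \<open>The average may be taken at any point \<open>w\<close> of the cube of \<open>x\<close>: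
  distances to the boundary within a cube differ by a factor of at most 5, so the ball about
  \<open>w\<close> lies within 4 d(x) of \<open>x\<close> and its volume is comparable to d(x)^n.
  Hence the kernel is at least a multiple of d(x)^(-n - sp) there. The constant 10 is 2 * 5, from n
  / (d(w)/2) <= 10 n / d(x).\<close>

lemma local_average_poincare:
  assumes sp: "0 < s" "1 < p"
  shows "\<exists>C>0. \<forall>f M Q x w. f \<in> borel_measurable borel \<and> (\<forall>x. \<bar>f x\<bar> \<le> M) \<and> Q \<in> W \<and> x \<in> Q \<and> w \<in> Q \<longrightarrow>
    ennreal (\<bar>f x - local_average f w\<bar> powr p * d x powr (- (s * p)))
      \<le> ennreal C * (\<integral>\<^sup>+y\<in>G. gagliardo_integrand s p f x y \<partial>lborel)"
proof -
  define n where "n = real CARD('n)"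
  define \<omega> where "\<omega> = unit_ball_vol n"
  have \<omega>: "\<omega> > 0" unfolding \<omega>_def n_def by simp
  have n0: "n > 0" unfolding n_def by simp
  define C where "C = 4 powr (n + s * p) * (10 * n) powr n"
  have C: "C > 0" unfolding C_def using n0 by simp
  have [measurable]: "G \<in> sets borel" using G(1) by simp
  have ball: "emeasure lborel (ball (0::real^'n) 1) = ennreal \<omega>"
    using emeasure_ball[of 1 "0::real^'n"] by (simp add: \<omega>_def n_def)
  have main: "ennreal (\<bar>f x - local_average f w\<bar> powr p * d x powr (- (s * p)))
      \<le> ennreal C * (\<integral>\<^sup>+y\<in>G. gagliardo_integrand s p f x y \<partial>lborel)"
    if [measurable]: "f \<in> borel_measurable borel" and M: "\<And>x. \<bar>f x\<bar> \<le> M" and Q: "Q \<in> W" "x \<in> Q" "w \<in> Q" for f M Q x w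
  proof -
    interpret prob_space "uniform_measure lborel (ball (0::real^'n) 1)" by (rule prob_space_unit_ball)
    have G: "x \<in> G" "w \<in> G" using Q Union_cubes by auto
    have dx: "d x > 0" and dw: "d w > 0" using d_pos G by auto
    have dw5: "d w \<le> 5 * d x" "d x \<le> 5 * d w"
      using d_le_diameter[OF Q(1,3)] diameter_le_d[OF Q(1,2)] d_le_diameter[OF Q(1,2)] diameter_le_d[OF Q(1,3)] by auto
    have xw: "dist x w \<le> d x"
      using diameter_bounded_bound[OF compact_imp_bounded[OF dyadic_cube_compact[OF dyadic[OF Q(1)]]] Q(2,3)]
        diameter_le_d[OF Q(1,2)] by simp
    let ?R = "(4 * d x) powr (n + s * p)"
    define h where "h y = gagliardo_integrand s p f x y * indicator G y" for y
    have [measurable]: "h \<in> borel_measurable borel" unfolding h_def by measurable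
    have "ennreal (\<bar>f x - local_average f w\<bar> powr p)
      \<le> (\<integral>\<^sup>+z. ennreal (\<bar>f x - f (local_shift z w)\<bar> powr p) \<partial>uniform_measure lborel (ball 0 1))"
      unfolding local_average_def
      by (rule abs_diff_expectation_powr_le[OF sp(2) integrable_local_shift[OF that(1) M]])
    also have "\<dots> = (\<integral>\<^sup>+z\<in>ball 0 1. ennreal (\<bar>f x - f (local_shift z w)\<bar> powr p) \<partial>lborel) / ennreal \<omega>"
      by (subst nn_integral_uniform_measure) (auto simp: ball)
    also have "(\<integral>\<^sup>+z\<in>ball 0 1. ennreal (\<bar>f x - f (local_shift z w)\<bar> powr p) \<partial>lborel)
      \<le> (\<integral>\<^sup>+z. ennreal ?R * h (w + (d w / 2) *\<^sub>R z) \<partial>lborel)"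
    proof (rule nn_integral_mono)
      fix z :: "real^'n"
      let ?y = "local_shift z w"
      show "ennreal (\<bar>f x - f ?y\<bar> powr p) * indicator (ball 0 1) z \<le> ennreal ?R * h (w + (d w / 2) *\<^sub>R z)"
      proof (cases "z \<in> ball 0 1 \<and> x \<noteq> ?y")
        case True
        then have z: "norm z < 1" by simp
        have "norm (x - ?y) \<le> dist x w + dist w ?y" using dist_triangle[of x ?y w] by (simp add: dist_norm)
        also have "\<dots> \<le> 4 * d x" using xw dist_local_shift[OF z, of w] dw5 dx by linarith
        finally have "norm (x - ?y) powr (n + s * p) \<le> ?R" using sp n0 by (intro powr_mono2) auto
        then have "\<bar>f x - f ?y\<bar> powr p * norm (x - ?y) powr (n + s * p) \<le> ?R * \<bar>f x - f ?y\<bar> powr p"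
          by (subst mult.commute) (intro mult_right_mono, auto)
        then have "\<bar>f x - f ?y\<bar> powr p \<le> ?R * (\<bar>f x - f ?y\<bar> powr p / norm (x - ?y) powr (n + s * p))"
          using True by (simp add: field_simps)
        then have "ennreal (\<bar>f x - f ?y\<bar> powr p) \<le> ennreal ?R * gagliardo_integrand s p f x ?y"
          unfolding gagliardo_integrand_def n_def[symmetric]
          by (subst ennreal_mult[symmetric]) (auto intro: ennreal_leI)
        then show ?thesis using True local_shift_in[OF z G(2)] by (simp add: h_def local_shift_def)
      next
        case False
        then show ?thesis using sp by (auto simp: indicator_def)
      qed
    qed
    also have "\<dots> = ennreal ?R * (\<integral>\<^sup>+z. h (w + (d w / 2) *\<^sub>R z) \<partial>lborel)"
      by (rule nn_integral_cmult) measurable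
    also have "(\<integral>\<^sup>+z. h (w + (d w / 2) *\<^sub>R z) \<partial>lborel) \<le> ennreal (\<omega> * (n / (d w / 2)) powr n) * (\<integral>\<^sup>+y. h y \<partial>lborel)"
      using nn_integral_expanding_le[of "d w / 2" "\<lambda>z. w + (d w / 2) *\<^sub>R z" h] dw n0
      by (simp add: \<omega>_def n_def powr_realpow dist_norm scaleR_diff_right[symmetric] continuous_intros)
    finally have "ennreal (\<bar>f x - local_average f w\<bar> powr p)
       \<le> ennreal ?R * (ennreal (\<omega> * (n / (d w / 2)) powr n) * (\<integral>\<^sup>+y. h y \<partial>lborel)) / ennreal \<omega>"
      by (simp add: divide_right_mono_ennreal mult_left_mono)
    also have "\<dots> = ennreal ?R * ennreal (\<omega> * (n / (d w / 2)) powr n) * ennreal (1 / \<omega>) * (\<integral>\<^sup>+y. h y \<partial>lborel)"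
      using \<omega> by (simp add: divide_ennreal_def inverse_ennreal mult_ac inverse_eq_divide)
    also have "ennreal ?R * ennreal (\<omega> * (n / (d w / 2)) powr n) * ennreal (1 / \<omega>)
        = ennreal (?R * (\<omega> * (n / (d w / 2)) powr n) / \<omega>)"
      using \<omega> by (simp only: ennreal_mult[symmetric] powr_ge_zero mult_nonneg_nonneg less_imp_le
          zero_le_divide_1_iff) simp
    also have "?R * (\<omega> * (n / (d w / 2)) powr n) / \<omega> = ?R * (n / (d w / 2)) powr n" using \<omega> by simp
    also have "ennreal (?R * (n / (d w / 2)) powr n) \<le> ennreal (?R * (10 * n / d x) powr n)"
      using dw dx dw5 n0 by (intro ennreal_leI mult_left_mono powr_mono2) (auto simp: field_simps)
    finally have *: "ennreal (\<bar>f x - local_average f w\<bar> powr p) \<le> ennreal (?R * (10 * n / d x) powr n) * (\<integral>\<^sup>+y. h y \<partial>lborel)"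
      by (simp add: mult_right_mono)
    have "ennreal (\<bar>f x - local_average f w\<bar> powr p * d x powr (- (s * p)))
      = ennreal (d x powr (- (s * p))) * ennreal (\<bar>f x - local_average f w\<bar> powr p)"
      by (simp add: ennreal_mult[symmetric] mult.commute)
    also have "\<dots> \<le> ennreal (d x powr (- (s * p))) * (ennreal (?R * (10 * n / d x) powr n) * (\<integral>\<^sup>+y. h y \<partial>lborel))"
      using * by (rule mult_left_mono) simp
    also have "\<dots> = ennreal (d x powr (- (s * p)) * (?R * (10 * n / d x) powr n)) * (\<integral>\<^sup>+y. h y \<partial>lborel)"
      by (simp add: ennreal_mult mult.assoc)
    also have "d x powr (- (s * p)) * (?R * (10 * n / d x) powr n) = C"
      using dx n0 by (simp add: C_def powr_mult powr_divide powr_add powr_minus field_simps)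
    finally show ?thesis by (simp add: h_def)
  qed
  show ?thesis using main C by (intro exI[of _ C]) blast
qed

end

section \<open>Summation over dyadic levels and Hardy's inequality\<close>

lemma gagliardo_energy_cmult:
  fixes u :: "real^'n \<Rightarrow> real"
  assumes [measurable]: "u \<in> borel_measurable borel" "G \<in> sets borel"
  shows "gagliardo_energy s p G (\<lambda>x. k * u x) = ennreal (\<bar>k\<bar> powr p) * gagliardo_energy s p G u"
proof -
  have "gagliardo_integrand s p (\<lambda>x. k * u x) x y = ennreal (\<bar>k\<bar> powr p) * gagliardo_integrand s p u x y" for x y
    by (simp add: gagliardo_integrand_def right_diff_distrib[symmetric] abs_mult powr_mult ennreal_mult[symmetric])
  then show ?thesis unfolding gagliardo_energy_eq
    by (simp add: mult.assoc nn_integral_cmult)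
qed

lemma sum_gagliardo_energy_le:
  fixes v :: "real^'n \<Rightarrow> real"
  assumes [measurable]: "G \<in> sets borel" and I: "finite I"
    and u: "\<And>k. k \<in> I \<Longrightarrow> u k \<in> borel_measurable borel"
    and le: "\<And>x y. (\<Sum>k\<in>I. \<bar>u k x - u k y\<bar> powr p) \<le> \<bar>v x - v y\<bar> powr p"
  shows "(\<Sum>k\<in>I. gagliardo_energy s p G (u k)) \<le> gagliardo_energy s p G v"
proof -
  have gm [measurable]: "(\<lambda>w. gagliardo_integrand s p (u k) (fst w) (snd w)) \<in> borel_measurable (borel \<Otimes>\<^sub>M borel)"
    "(\<lambda>y. gagliardo_integrand s p (u k) x y) \<in> borel_measurable borel" if "k \<in> I" for k x
    using u[OF that] by measurable
  have im: "(\<lambda>x. \<integral>\<^sup>+y\<in>G. gagliardo_integrand s p (u k) x y \<partial>lborel) \<in> borel_measurable borel" if "k \<in> I" for k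
    using gm[OF that] by measurable
  have "(\<Sum>k\<in>I. gagliardo_energy s p G (u k))
      = (\<integral>\<^sup>+x. (\<Sum>k\<in>I. (\<integral>\<^sup>+y\<in>G. gagliardo_integrand s p (u k) x y \<partial>lborel) * indicator G x) \<partial>lborel)"
    unfolding gagliardo_energy_eq by (rule nn_integral_sum[symmetric]) (use im in auto)
  also have "\<dots> = (\<integral>\<^sup>+x\<in>G. (\<integral>\<^sup>+y\<in>G. (\<Sum>k\<in>I. gagliardo_integrand s p (u k) x y) \<partial>lborel) \<partial>lborel)"
    by (intro nn_integral_cong, subst sum_distrib_right[symmetric], subst nn_integral_sum[symmetric])
      (use gm(2) in \<open>auto simp: sum_distrib_right\<close>)
  also have "\<dots> \<le> gagliardo_energy s p G v"
  proof -
    have "(\<Sum>k\<in>I. gagliardo_integrand s p (u k) x y) \<le> gagliardo_integrand s p v x y" for x y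
      unfolding gagliardo_integrand_def using le[of x y]
      by (subst sum_ennreal) (auto simp: sum_divide_distrib[symmetric] intro!: ennreal_leI divide_right_mono)
    then show ?thesis unfolding gagliardo_energy_eq
      by (intro nn_integral_mono mult_right_mono) auto
  qed
  finally show ?thesis .
qed

context whitney
begin

text \<open>Here \<open>a Q\<close> stands for side^(n - sp) and \<open>b Q\<close> for the minimum
  of |v| on \<open>Q\<close>. On cubes with \<open>b Q\<close> at least 2^(k+1) the layer
  \<open>k\<close> is full, so 2^(-k) times this layer tests the capacity of their union, and
  quasiadditivity bounds the sum of their \<open>a Q\<close>. The weight 2^(kp) turns the energy of
  the test function into that of the layer.\<close>

lemma level_sum_le:
  assumes p: "1 < p" and N: "N > 0" "C > 0"
    and quasi: "\<And>E. E \<subseteq> W \<Longrightarrow> finite E \<Longrightarrow>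
        (\<Sum>\<^sub>\<infinity>Q\<in>W. capacity s p (\<Union>E \<inter> Q) G) \<le> ennreal N * capacity s p (\<Union>E) G"
    and cap: "\<And>Q. Q \<in> W \<Longrightarrow> ennreal (a Q) \<le> ennreal C * capacity s p Q G"
    and v: "v \<in> compactly_supported G" "continuous_on UNIV v"
    and F: "finite F" "F \<subseteq> W"
    and b: "\<And>Q. Q \<in> F \<Longrightarrow> 0 \<le> b Q" "\<And>Q x. Q \<in> F \<Longrightarrow> x \<in> Q \<Longrightarrow> b Q \<le> \<bar>v x\<bar>"
    and a: "\<And>Q. Q \<in> F \<Longrightarrow> 0 \<le> a Q"
  shows "(\<Sum>Q\<in>F. ennreal (b Q powr p * a Q)) \<le> ennreal (4 powr p * (C * N)) * gagliardo_energy s p G v"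
proof -
  have p0: "0 < p" using p by simp
  have [measurable]: "v \<in> borel_measurable borel" using v(2) by (rule borel_measurable_continuous_onI)
  have [measurable]: "G \<in> sets borel" using G(1) by simp
  \<comment> \<open>Layer \<open>k\<close> attains its full height 2^k only from 2^(k+1) on, hence
    the index one below the integer part of the logarithm. Only cubes with positive
    \<open>b Q\<close> have a level.\<close>
  define I where "I = (\<lambda>Q. \<lfloor>log 2 (b Q)\<rfloor> - 1) ` {Q\<in>F. b Q > 0}"
  have I: "finite I" using F(1) by (simp add: I_def)
  define E where "E k = {Q\<in>F. 2 powr (real_of_int k + 1) \<le> b Q}" for k :: int
  have E: "finite (E k)" "E k \<subseteq> W" "E k \<subseteq> F" for k using F by (auto simp: E_def)
  define g where "g k x = dyadic_layer k \<bar>v x\<bar>" for k :: int and x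
  define t where "t k x = inverse (2 powr real_of_int k) * g k x" for k :: int and x
  have gcont: "continuous_on UNIV (g k)" for k
    unfolding g_def dyadic_layer_def by (intro continuous_intros v(2))
  have gmeas [measurable]: "g k \<in> borel_measurable borel" for k
    using gcont by (rule borel_measurable_continuous_onI)
  have test: "capacity s p (\<Union>(E k)) G \<le> gagliardo_energy s p G (t k)" for k
  proof (rule capacity_le[OF p0])
    have "continuous_on UNIV (t k)" unfolding t_def by (intro continuous_intros gcont)
    then show "t k \<in> compactly_supported G"
      using continuous_on_subset by (intro compactly_supported_subset[OF v(1)])
        (auto simp: t_def g_def dyadic_layer_def)
  next
    fix x assume "x \<in> \<Union>(E k)"
    then obtain Q where Q: "Q \<in> E k" "x \<in> Q" by auto
    then have "2 powr (real_of_int k + 1) \<le> \<bar>v x\<bar>" using b(2)[of Q x] by (force simp: E_def)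
    then show "t k x \<ge> 1" by (simp add: t_def g_def dyadic_layer_def powr_add)
  qed
  \<comment> \<open>One level is enough for each cube: with this \<open>k\<close>, 2^(k+1) <= b <= 4
    * 2^k, which is the source of 4^p. The remaining levels add nonnegative terms.\<close>
  have split: "ennreal (b Q powr p * a Q)
      \<le> (\<Sum>k\<in>I. if Q \<in> E k then ennreal (4 powr p * 2 powr (k * p)) * ennreal (a Q) else 0)" if Q: "Q \<in> F" for Q
  proof (cases "b Q > 0")
    case True
    define k where "k = \<lfloor>log 2 (b Q)\<rfloor> - 1"
    have k: "k \<in> I" using True Q by (auto simp: I_def k_def)
    have "2 powr (real_of_int k + 1) \<le> 2 powr (log 2 (b Q))"
      unfolding k_def by (intro powr_mono) (auto simp: of_int_floor_le)
    then have QE: "Q \<in> E k" using Q True by (simp add: E_def)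
    have "2 powr (log 2 (b Q)) \<le> 2 powr (real_of_int k + 2)"
    proof (rule powr_mono)
      show "log 2 (b Q) \<le> real_of_int k + 2" unfolding k_def by linarith
    qed simp
    then have "b Q \<le> 4 * 2 powr k" using True by (simp add: powr_add)
    then have "b Q powr p \<le> (4 * 2 powr k) powr p" using True p0 by (intro powr_mono2) auto
    also have "\<dots> = 4 powr p * 2 powr (k * p)" by (simp add: powr_mult powr_powr)
    finally have "ennreal (b Q powr p * a Q) \<le> ennreal (4 powr p * 2 powr (k * p)) * ennreal (a Q)"
      using a[OF Q] by (subst ennreal_mult[symmetric]) (auto intro!: ennreal_leI mult_right_mono)
    also have "\<dots> = (if Q \<in> E k then ennreal (4 powr p * 2 powr (k * p)) * ennreal (a Q) else 0)" using QE by simp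
    also have "\<dots> \<le> (\<Sum>k\<in>I. if Q \<in> E k then ennreal (4 powr p * 2 powr (k * p)) * ennreal (a Q) else 0)"
      by (rule member_le_sum[OF k _ I]) simp
    finally show ?thesis .
  qed (use b(1)[OF Q] p0 in auto)
  have capE: "(\<Sum>Q\<in>E k. ennreal (a Q)) \<le> ennreal (C * N) * gagliardo_energy s p G (t k)" for k
  proof -
    have "(\<Sum>Q\<in>E k. ennreal (a Q)) \<le> (\<Sum>Q\<in>E k. ennreal C * capacity s p (\<Union>(E k) \<inter> Q) G)"
    proof (rule sum_mono)
      fix Q assume Q: "Q \<in> E k"
      then have "\<Union>(E k) \<inter> Q = Q" by auto
      then show "ennreal (a Q) \<le> ennreal C * capacity s p (\<Union>(E k) \<inter> Q) G" using cap[of Q] Q E(2)[of k] by auto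
    qed
    also have "\<dots> = ennreal C * (\<Sum>Q\<in>E k. capacity s p (\<Union>(E k) \<inter> Q) G)" by (simp add: sum_distrib_left)
    also have "(\<Sum>Q\<in>E k. capacity s p (\<Union>(E k) \<inter> Q) G) \<le> (\<Sum>\<^sub>\<infinity>Q\<in>W. capacity s p (\<Union>(E k) \<inter> Q) G)"
      using E by (subst nonneg_infsum_complete) (auto intro!: SUP_upper)
    also have "\<dots> \<le> ennreal N * capacity s p (\<Union>(E k)) G" using quasi E by simp
    also have "capacity s p (\<Union>(E k)) G \<le> gagliardo_energy s p G (t k)" by (rule test)
    finally show ?thesis using N by (simp add: mult_left_mono ennreal_mult mult.assoc)
  qed
  have scale: "ennreal (2 powr (k * p)) * gagliardo_energy s p G (t k) = gagliardo_energy s p G (g k)" for k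
  proof -
    have "gagliardo_energy s p G (t k) = ennreal (inverse (2 powr real_of_int k) powr p) * gagliardo_energy s p G (g k)"
      unfolding t_def by (subst gagliardo_energy_cmult) auto
    moreover have "(2::real) powr (k * p) * inverse (2 powr real_of_int k) powr p = 1"
      by (simp add: powr_powr[symmetric] powr_mult[symmetric])
    ultimately show ?thesis by (simp add: mult.assoc[symmetric] ennreal_mult[symmetric])
  qed
  have "(\<Sum>Q\<in>F. ennreal (b Q powr p * a Q))
      \<le> (\<Sum>Q\<in>F. \<Sum>k\<in>I. if Q \<in> E k then ennreal (4 powr p * 2 powr (k * p)) * ennreal (a Q) else 0)"
    by (rule sum_mono) (rule split)
  also have "\<dots> = (\<Sum>k\<in>I. \<Sum>Q\<in>F. if Q \<in> E k then ennreal (4 powr p * 2 powr (k * p)) * ennreal (a Q) else 0)"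
    by (rule sum.swap)
  also have "\<dots> = (\<Sum>k\<in>I. ennreal (4 powr p * 2 powr (k * p)) * (\<Sum>Q\<in>E k. ennreal (a Q)))"
  proof (rule sum.cong[OF refl])
    fix k
    have "F \<inter> {Q. Q \<in> E k} = E k" using E(3) by auto
    then show "(\<Sum>Q\<in>F. if Q \<in> E k then ennreal (4 powr p * 2 powr (k * p)) * ennreal (a Q) else 0)
        = ennreal (4 powr p * 2 powr (k * p)) * (\<Sum>Q\<in>E k. ennreal (a Q))"
      using F(1) by (simp add: sum.If_cases sum_distrib_left)
  qed
  also have "\<dots> \<le> (\<Sum>k\<in>I. ennreal (4 powr p * 2 powr (k * p)) * (ennreal (C * N) * gagliardo_energy s p G (t k)))"
    by (intro sum_mono mult_left_mono capE) simp
  also have "\<dots> = ennreal (4 powr p * (C * N)) * (\<Sum>k\<in>I. gagliardo_energy s p G (g k))"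
    unfolding sum_distrib_left scale[symmetric]
    using N by (intro sum.cong refl) (simp add: ennreal_mult mult_ac)
  also have "(\<Sum>k\<in>I. gagliardo_energy s p G (g k)) \<le> gagliardo_energy s p G v"
  proof (rule sum_gagliardo_energy_le[OF _ I])
    fix x y
    have "(\<Sum>k\<in>I. \<bar>g k x - g k y\<bar> powr p) \<le> \<bar>\<bar>v x\<bar> - \<bar>v y\<bar>\<bar> powr p"
      unfolding g_def using sum_dyadic_layer_diff_powr_le[OF I] p by simp
    also have "\<dots> \<le> \<bar>v x - v y\<bar> powr p" using p0 by (intro powr_mono2) auto
    finally show "(\<Sum>k\<in>I. \<bar>g k x - g k y\<bar> powr p) \<le> \<bar>v x - v y\<bar> powr p" .
  qed auto
  finally show ?thesis by (simp add: mult_left_mono)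
qed

text \<open>On each cube the function is compared with its average at the point where |v| is
  smallest. The difference is a Poincare term, and the minimum is a constant on the cube, as
  \<open>level_sum_le\<close> requires.\<close>

lemma weakly_quasiadditive_imp_hardy:
  assumes sp: "0 < s" "1 < p" "s * p < real CARD('n)"
    and Z: "admits_zero_extension s p G" and QA: "weakly_quasiadditive s p G W"
  shows "hardy_inequality s p G"
proof -
  have p0: "0 < p" using sp by simp
  define n where "n = real CARD('n)"
  obtain N where N: "N > 0" "\<And>E. E \<subseteq> W \<Longrightarrow> finite E \<Longrightarrow>
        (\<Sum>\<^sub>\<infinity>Q\<in>W. capacity s p (\<Union>E \<inter> Q) G) \<le> ennreal N * capacity s p (\<Union>E) G"
    using QA unfolding weakly_quasiadditive_def by auto
  obtain C1 where C1: "C1 > 0" "\<And>Q. Q \<in> W \<Longrightarrow> ennreal (side Q powr (n - s * p)) \<le> ennreal C1 * capacity s p Q G"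
    using capacity_cube_ge[OF sp Z] unfolding n_def by auto
  obtain C2 where C2: "C2 > 0" "\<And>f M. f \<in> borel_measurable borel \<Longrightarrow> (\<And>x. \<bar>f x\<bar> \<le> M) \<Longrightarrow>
      gagliardo_energy s p G (local_average f) \<le> ennreal C2 * gagliardo_energy s p G f"
    using gagliardo_energy_local_average_le[OF sp(1,2)] by auto
  obtain C3 where C3: "C3 > 0" "\<forall>f M Q x w. f \<in> borel_measurable borel \<and> (\<forall>x. \<bar>f x\<bar> \<le> M) \<and> Q \<in> W \<and> x \<in> Q \<and> w \<in> Q \<longrightarrow>
      ennreal (\<bar>f x - local_average f w\<bar> powr p * d x powr (- (s * p)))
      \<le> ennreal C3 * (\<integral>\<^sup>+y\<in>G. gagliardo_integrand s p f x y \<partial>lborel)"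
    using local_average_poincare[OF sp(1,2)] by blast
  have [measurable]: "G \<in> sets borel" using G(1) by simp
  have [measurable]: "d \<in> borel_measurable borel"
    by (intro borel_measurable_continuous_onI continuous_intros)
  have Wm [measurable]: "Q \<in> sets borel" if "Q \<in> W" for Q
    using dyadic_cube_compact[OF dyadic[OF that]] by (simp add: borel_compact)
  have Wc: "countable W" using countable_dyadic_cubes by (rule countable_subset[rotated]) (use dyadic in auto)
  \<comment> \<open>The factors 2^p come from splitting the power of a sum. The first term is the
    Poincare part; the second is the sum over levels followed by the energy bound for the
    average.\<close>
  define B where "B = 2 powr p * C3 + 2 powr p * (4 powr p * (C1 * N) * C2)"
  have B: "B > 0" unfolding B_def using C1 C2 C3 N by (intro add_pos_pos mult_pos_pos) auto
  have "hardy_integral s p G u \<le> ennreal B * gagliardo_energy s p G u" if u: "u \<in> compactly_supported G" for u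
  proof -
    define f where "f = zero_ext G u"
    define v where "v = local_average f"
    have fc: "continuous_on UNIV f" unfolding f_def by (rule continuous_on_zero_ext[OF G(1) u])
    have fm [measurable]: "f \<in> borel_measurable borel" using fc by (rule borel_measurable_continuous_onI)
    obtain M where M: "\<And>x. \<bar>f x\<bar> \<le> M" using zero_ext_bounds[OF G(1) u] unfolding f_def by blast
    have vc: "continuous_on UNIV v" unfolding v_def by (rule continuous_on_local_average[OF fc M])
    have vs: "v \<in> compactly_supported G" unfolding v_def f_def by (rule local_average_compactly_supported[OF u])
    have "\<exists>w\<in>Q. \<forall>x\<in>Q. \<bar>v w\<bar> \<le> \<bar>v x\<bar>" if "Q \<in> W" for Q
      using dyadic[OF that] continuous_on_subset[OF vc]
      by (intro continuous_attains_inf dyadic_cube_compact dyadic_cube_nonempty continuous_intros) auto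
    then obtain w where w: "\<And>Q. Q \<in> W \<Longrightarrow> w Q \<in> Q" "\<And>Q x. Q \<in> W \<Longrightarrow> x \<in> Q \<Longrightarrow> \<bar>v (w Q)\<bar> \<le> \<bar>v x\<bar>"
      by metis
    define \<Phi> where "\<Phi> x = (\<integral>\<^sup>+y\<in>G. gagliardo_integrand s p f x y \<partial>lborel)" for x
    have [measurable]: "\<Phi> \<in> borel_measurable borel" unfolding \<Phi>_def by measurable
    define h where "h x = ennreal (\<bar>f x\<bar> powr p * d x powr (- (s * p)))" for x
    have [measurable]: "h \<in> borel_measurable borel" unfolding h_def by measurable
    define e where "e Q = ennreal (\<bar>v (w Q)\<bar> powr p * side Q powr (- (s * p)))" for Q
    have pw: "h x \<le> ennreal (2 powr p) * (ennreal C3 * \<Phi> x + e Q)" if Q: "Q \<in> W" "x \<in> Q" for x Q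
    proof -
      have d: "side Q \<le> d x" "0 < side Q"
        using side_le_diameter diameter_le_d side_pos Q by force+
      have "\<bar>f x\<bar> \<le> \<bar>f x - v (w Q)\<bar> + \<bar>v (w Q)\<bar>" by linarith
      then have "\<bar>f x\<bar> powr p \<le> (\<bar>f x - v (w Q)\<bar> + \<bar>v (w Q)\<bar>) powr p" using p0 by (intro powr_mono2) auto
      also have "\<dots> \<le> 2 powr p * (\<bar>f x - v (w Q)\<bar> powr p + \<bar>v (w Q)\<bar> powr p)"
        using p0 by (intro powr_add_le) auto
      finally have "\<bar>f x\<bar> powr p * d x powr (- (s * p))
          \<le> 2 powr p * (\<bar>f x - v (w Q)\<bar> powr p + \<bar>v (w Q)\<bar> powr p) * d x powr (- (s * p))"
        by (rule mult_right_mono) simp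
      also have "\<dots> = 2 powr p * (\<bar>f x - v (w Q)\<bar> powr p * d x powr (- (s * p)) + \<bar>v (w Q)\<bar> powr p * d x powr (- (s * p)))"
        by (simp add: algebra_simps)
      also have "\<dots> \<le> 2 powr p * (\<bar>f x - v (w Q)\<bar> powr p * d x powr (- (s * p)) + \<bar>v (w Q)\<bar> powr p * side Q powr (- (s * p)))"
        using d sp p0 by (intro mult_left_mono add_left_mono powr_mono2') auto
      finally have "h x \<le> ennreal (2 powr p * (\<bar>f x - v (w Q)\<bar> powr p * d x powr (- (s * p)) + \<bar>v (w Q)\<bar> powr p * side Q powr (- (s * p))))"
        unfolding h_def by (rule ennreal_leI)
      also have "\<dots> = ennreal (2 powr p) * (ennreal (\<bar>f x - v (w Q)\<bar> powr p * d x powr (- (s * p))) + e Q)"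
        by (simp add: ennreal_mult e_def)
      also have "ennreal (\<bar>f x - v (w Q)\<bar> powr p * d x powr (- (s * p))) \<le> ennreal C3 * \<Phi> x"
        unfolding v_def \<Phi>_def using fm M Q w(1)[OF Q(1)]
        by (intro C3(2)[rule_format, where Q = Q and M = M]) auto
      finally show ?thesis by (simp add: mult_left_mono add_right_mono)
    qed
    have fin: "(\<integral>\<^sup>+x\<in>\<Union>F. h x \<partial>lborel) \<le> ennreal B * gagliardo_energy s p G u" if F: "finite F" "F \<subseteq> W" for F
    proof -
      have FG: "\<Union>F \<subseteq> G" using F(2) Union_cubes by blast
      have "(\<integral>\<^sup>+x\<in>\<Union>F. h x \<partial>lborel)
        \<le> (\<integral>\<^sup>+x. ennreal (2 powr p) * (ennreal C3 * (\<Phi> x * indicator G x) + (\<Sum>Q\<in>F. e Q * indicator Q x)) \<partial>lborel)"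
      proof (rule nn_integral_mono)
        fix x
        show "h x * indicator (\<Union>F) x \<le> ennreal (2 powr p) * (ennreal C3 * (\<Phi> x * indicator G x) + (\<Sum>Q\<in>F. e Q * indicator Q x))"
        proof (cases "x \<in> \<Union>F")
          case True
          then obtain Q where Q: "Q \<in> F" "x \<in> Q" by auto
          \<comment> \<open>A point on a common face lies in several cubes, so more than one
            \<open>e Q\<close> may be counted there; this only enlarges the upper bound.\<close>
          have "e Q * indicator Q x \<le> (\<Sum>Q\<in>F. e Q * indicator Q x)"
            by (rule member_le_sum[OF Q(1) _ F(1)]) simp
          then have "e Q \<le> (\<Sum>Q\<in>F. e Q * indicator Q x)" using Q(2) by simp
          moreover have "h x \<le> ennreal (2 powr p) * (ennreal C3 * \<Phi> x + e Q)" using pw Q F(2) by blast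
          ultimately have "h x \<le> ennreal (2 powr p) * (ennreal C3 * \<Phi> x + (\<Sum>Q\<in>F. e Q * indicator Q x))"
            by (meson add_left_mono mult_left_mono order_trans zero_le)
          moreover have "x \<in> G" using True FG by auto
          ultimately show ?thesis using True by simp
        qed simp
      qed
      also have "\<dots> = ennreal (2 powr p) * (ennreal C3 * (\<integral>\<^sup>+x. \<Phi> x * indicator G x \<partial>lborel) + (\<Sum>Q\<in>F. e Q * emeasure lborel Q))"
      proof -
        have m: "(\<lambda>x. e Q * indicator Q x) \<in> borel_measurable borel" if "Q \<in> F" for Q
          using Wm[of Q] F(2) that by (intro borel_measurable_times_ennreal borel_measurable_indicator) auto
        then have ms: "(\<lambda>x. \<Sum>Q\<in>F. e Q * indicator Q x) \<in> borel_measurable borel"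
          by (intro borel_measurable_sum) auto
        have "(\<integral>\<^sup>+x. (\<Sum>Q\<in>F. e Q * indicator Q x) \<partial>lborel) = (\<Sum>Q\<in>F. \<integral>\<^sup>+x. e Q * indicator Q x \<partial>lborel)"
          by (rule nn_integral_sum) (use m in auto)
        also have "\<dots> = (\<Sum>Q\<in>F. e Q * emeasure lborel Q)"
          using Wm F(2) by (intro sum.cong refl nn_integral_cmult_indicator) auto
        finally show ?thesis using ms by (simp add: nn_integral_cmult nn_integral_add)
      qed
      also have "(\<integral>\<^sup>+x. \<Phi> x * indicator G x \<partial>lborel) = gagliardo_energy s p G f"
        unfolding \<Phi>_def gagliardo_energy_eq ..
      also have "(\<Sum>Q\<in>F. e Q * emeasure lborel Q) = (\<Sum>Q\<in>F. ennreal (\<bar>v (w Q)\<bar> powr p * side Q powr (n - s * p)))"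
      proof (rule sum.cong[OF refl])
        fix Q assume "Q \<in> F"
        then have Q: "Q \<in> W" using F by auto
        show "e Q * emeasure lborel Q = ennreal (\<bar>v (w Q)\<bar> powr p * side Q powr (n - s * p))"
          unfolding e_def emeasure_dyadic_cube[OF dyadic[OF Q]] n_def[symmetric]
          by (subst ennreal_mult[symmetric]) (auto simp: powr_diff powr_minus divide_inverse mult_ac)
      qed
      also have "(\<Sum>Q\<in>F. ennreal (\<bar>v (w Q)\<bar> powr p * side Q powr (n - s * p)))
          \<le> ennreal (4 powr p * (C1 * N)) * gagliardo_energy s p G v"
        using F w by (intro level_sum_le[OF sp(2) N(1) C1(1) N(2) C1(2) vs vc]) auto
      also have "gagliardo_energy s p G v \<le> ennreal C2 * gagliardo_energy s p G f"
        unfolding v_def by (rule C2(2)[OF fm M])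
      finally have "(\<integral>\<^sup>+x\<in>\<Union>F. h x \<partial>lborel) \<le> ennreal (2 powr p) * (ennreal C3 * gagliardo_energy s p G f
          + ennreal (4 powr p * (C1 * N)) * (ennreal C2 * gagliardo_energy s p G f))"
        by (simp add: mult_left_mono add_left_mono)
      also have "\<dots> = ennreal B * gagliardo_energy s p G f"
        unfolding B_def using C1(1) C2(1) C3(1) N(1)
        by (simp add: ennreal_mult distrib_left distrib_right mult.assoc)
      finally show ?thesis by (simp add: f_def gagliardo_energy_zero_ext)
    qed
    have "hardy_integral s p G u = hardy_integral s p G f" by (simp add: f_def hardy_integral_zero_ext)
    also have "\<dots> = (\<integral>\<^sup>+x\<in>\<Union>W. h x \<partial>lborel)" by (simp add: hardy_integral_def h_def Union_cubes)
    also have "\<dots> \<le> ennreal B * gagliardo_energy s p G u"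
      by (rule nn_integral_Union_le[OF Wc]) (use Wm fin in auto)
    finally show ?thesis .
  qed
  then show ?thesis unfolding hardy_inequality_iff[OF p0] using B by auto
qed

end

theorem theorem2:
  fixes s p c :: real and G :: "(real^'n) set" and W :: "(real^'n) set set"
  assumes "0 < s" "s < 1" "1 < p" "s * p < real CARD('n)"
    and "open G" "G \<noteq> {}"
    and "whitney_decomposition c G W"
  shows "(bounded G \<longrightarrow>
            (hardy_inequality s p G \<longleftrightarrow> quasiadditive s p G W \<and> admits_zero_extension s p G) \<and>
            (quasiadditive s p G W \<and> admits_zero_extension s p G \<longleftrightarrow>
               weakly_quasiadditive s p G W \<and> admits_zero_extension s p G)) \<and>
         (\<not> bounded G \<and> G \<noteq> UNIV \<longrightarrow>
            (hardy_inequality s p G \<longrightarrow> quasiadditive s p G W \<and> admits_zero_extension s p G) \<and>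
            (quasiadditive s p G W \<and> admits_zero_extension s p G \<longrightarrow>
               weakly_quasiadditive s p G W \<and> admits_zero_extension s p G))"
proof -
  have equiv: "(hardy_inequality s p G \<longleftrightarrow> quasiadditive s p G W \<and> admits_zero_extension s p G) \<and>
      (quasiadditive s p G W \<and> admits_zero_extension s p G \<longleftrightarrow>
        weakly_quasiadditive s p G W \<and> admits_zero_extension s p G)" if "G \<noteq> UNIV"
  proof -
    interpret whitney c G W using assms that by unfold_locales auto
    show ?thesis
      using hardy_imp_zero_extension[OF assms(1-3,5) that] hardy_imp_quasiadditive[OF assms(1-3)]
        quasiadditive_imp_weakly weakly_quasiadditive_imp_hardy[OF assms(1,3,4)] by blast
  qed
  have "G \<noteq> UNIV" if "bounded G"
    using that not_bounded_UNIV by auto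
  with equiv show ?thesis by blast
qed

end
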